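(* Let $\mathcal C$ be a join restriction category with local glueings and let $X\in\mathcal C$. Restricting the adjunction $\Delta\dashv\Gamma\colon\mathcal C/_tX\to\mathrm{Psh}(X)$ to its fixpoints yields an equivalence of categories $$\Gamma\colon\mathcal C/_{\ell h}X\;\simeq\;\mathrm{Sh}(X)\;\colon\Delta$$ between the category of local homeomorphisms over $X$ and the category of sheaves on $X$.
   Context: A restriction category is a category with an operation assigning to each $f\colon A\to B$ a map $\bar f\colon A\to A$ such that $f\bar f=f$; $\bar f\bar g=\bar g\bar f$ and $\overline{g\bar f}=\bar g\bar f$ for $f\colon A\to B$, $g\colon A\to C$; and $\bar g f=f\,\overline{gf}$ for $f\colon A\to B$, $g\colon B\to C$. $\mathcal O(A)$ is the set of restriction idempotents on $A$ (maps $e\colon A\to A$ with $\bar e=e$). A map $f$ is total if $\bar f=1$. For parallel maps, $f\leqslant g$ iff $f=g\bar f$, and $f\smile g$ (compatible) iff $f\bar g=g\bar f$. A join restriction category is a restriction category in which every pairwise-compatible family of parallel maps has a join for $\leqslant$, and these joins are preserved by precomposition (then each $\mathcal O(A)$ is a locale). A partial isomorphism is a map $s\colon A\to B$ with a (necessarily unique) partial inverse $s^*\colon B\to A$: $s^*s=\bar s$, $ss^*=\overline{s^*}$. A local homeomorphism is a total map which is a join of partial isomorphisms. A local atlas on $X$ is a set $I$ and a family $\varphi_{ij}\in\mathcal O(X)$ ($i,j\in I$) with $\varphi_{ij}=\varphi_{ji}$ and $\varphi_{jk}\varphi_{ij}\leqslant\varphi_{ik}$. A glueing of $\varphi$ is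 a local homeomorphism $p=\bigvee_i p_i\colon A\to X$, with each $p_i$ a partial isomorphism with partial inverse $s_i$, such that $\varphi_{ij}=p_js_i$. $\mathcal C$ has local glueings if every local atlas on every object has a glueing. A partial section of a total map $p\colon A\to X$ is a map $s\colon X\to A$ with $ps=\bar s$. $\mathcal C/_tX$ is the category whose objects are total maps $p\colon A\to X$ and whose maps $p\to q$ are maps $f$ with $qf=p$; $\mathcal C/_{\ell h}X$ is its full subcategory on the local homeomorphisms. A presheaf on $X$ is a set $A$ with an associative unital right action $A\times\mathcal O(X)\to A$, $(a,e)\mapsto ae$ (where $\mathcal O(X)$ is a monoid under composition), and an extent operation $A\to\mathcal O(X)$, $a\mapsto\bar a$, with $a\bar a=a$ and $\overline{ae}=\bar ae$. Put $a\leqslant b$ iff $a=b\bar a$, and $a\smile b$ iff $a\bar b=b\bar a$. $A$ is a sheaf if every pairwise-compatible family has a join for $\leqslant$. $\mathrm{Psh}(X)$ has as maps functions preserving the action and extent; $\mathrm{Sh}(X)$ is the full subcategory of sheaves. $\Gamma$ sends $p$ to the presheaf of partial sections of $p$, with action $s,e\mapsto s\circ e$ and extent $s\mapsto\bar s$, and sends $f\colon p\to q$ to $s\mapsto fs$. For $A\in\mathrm{Psh}(X)$ and $a,b\in A$ let $[\![a=b]\!]=\bigvee\{e\in\mathcal O(X): e\leqslant\bar a\bar b,\ ae=be\}$; then $\Delta A$ is a glueing $p_A\colon\Delta A\to X$ of the local atlas $([\![a=b]\!])_{a,b\in A}$, with associated partial sections $s_a$. $\Delta$ is left adjoint to $\Gamma$,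 with unit $A\to\Gamma\Delta A$ given by $a\mapsto s_a$. A left (resp. right) fixpoint of an adjunction is an object at which the counit (resp. unit) is invertible. *)

theory Defs
  imports Main "HOL-Library.FuncSet"
begin

section \<open>Categories, functors and adjunctions\<close>

text \<open>
  Composition is written in the usual (non-diagrammatic) order and is only meaningful on
  composable arrows; the components of a category are only constrained on \<open>Ob\<close> and \<open>Ar\<close>.
\<close>

record ('o, 'a) cat =
  Ob  :: "'o set"
  Ar  :: "'a set"
  src :: "'a \<Rightarrow> 'o"
  tgt :: "'a \<Rightarrow> 'o"
  ide :: "'o \<Rightarrow> 'a"
  cmp :: "'a \<Rightarrow> 'a \<Rightarrow> 'a"  (infixl "\<cdot>\<index>" 70)

definition hom :: "('o, 'a, 'z) cat_scheme \<Rightarrow> 'o \<Rightarrow> 'o \<Rightarrow> 'a set" where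
  "hom C A B = {f \<in> Ar C. src C f = A \<and> tgt C f = B}"

locale category =
  fixes C :: "('o, 'a, 'z) cat_scheme" (structure)
  assumes src_Ob: "f \<in> Ar C \<Longrightarrow> src C f \<in> Ob C"
    and tgt_Ob: "f \<in> Ar C \<Longrightarrow> tgt C f \<in> Ob C"
    and ide_hom: "A \<in> Ob C \<Longrightarrow> ide C A \<in> hom C A A"
    and cmp_hom: "\<lbrakk>f \<in> hom C A B; g \<in> hom C B D\<rbrakk> \<Longrightarrow> g \<cdot> f \<in> hom C A D"
    and cmp_ide_right: "f \<in> hom C A B \<Longrightarrow> f \<cdot> ide C A = f"
    and cmp_ide_left: "f \<in> hom C A B \<Longrightarrow> ide C B \<cdot> f = f"
    and cmp_assoc: "\<lbrakk>f \<in> hom C A B; g \<in> hom C B D; h \<in> hom C D E\<rbrakk>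
                      \<Longrightarrow> h \<cdot> (g \<cdot> f) = (h \<cdot> g) \<cdot> f"

definition is_iso :: "('o, 'a, 'z) cat_scheme \<Rightarrow> 'a \<Rightarrow> bool" where
  "is_iso C f \<longleftrightarrow> f \<in> Ar C \<and>
     (\<exists>g \<in> hom C (tgt C f) (src C f).
        g \<cdot>\<^bsub>C\<^esub> f = ide C (src C f) \<and> f \<cdot>\<^bsub>C\<^esub> g = ide C (tgt C f))"

definition full_subcat :: "('o, 'a) cat \<Rightarrow> ('o \<Rightarrow> bool) \<Rightarrow> ('o, 'a) cat" where
  "full_subcat C P = C\<lparr>Ob := {A \<in> Ob C. P A}, Ar := {f \<in> Ar C. P (src C f) \<and> P (tgt C f)}\<rparr>"

record ('o, 'a, 'p, 'b) ftor =
  on_ob :: "'o \<Rightarrow> 'p"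
  on_ar :: "'a \<Rightarrow> 'b"

definition is_functor ::
  "('o, 'a) cat \<Rightarrow> ('p, 'b) cat \<Rightarrow> ('o, 'a, 'p, 'b) ftor \<Rightarrow> bool" where
  "is_functor K L F \<longleftrightarrow> category K \<and> category L \<and>
     (\<forall>A \<in> Ob K. on_ob F A \<in> Ob L) \<and>
     (\<forall>f \<in> Ar K. on_ar F f \<in> hom L (on_ob F (src K f)) (on_ob F (tgt K f))) \<and>
     (\<forall>A \<in> Ob K. on_ar F (ide K A) = ide L (on_ob F A)) \<and>
     (\<forall>f \<in> Ar K. \<forall>g \<in> Ar K. tgt K f = src K g \<longrightarrow>
        on_ar F (g \<cdot>\<^bsub>K\<^esub> f) = on_ar F g \<cdot>\<^bsub>L\<^esub> on_ar F f)"

definition ftor_id :: "('o, 'a, 'o, 'a) ftor" where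
  "ftor_id = \<lparr>on_ob = (\<lambda>A. A), on_ar = (\<lambda>f. f)\<rparr>"

definition ftor_comp ::
  "('p, 'b, 'q, 'c) ftor \<Rightarrow> ('o, 'a, 'p, 'b) ftor \<Rightarrow> ('o, 'a, 'q, 'c) ftor" where
  "ftor_comp G F = \<lparr>on_ob = (\<lambda>A. on_ob G (on_ob F A)), on_ar = (\<lambda>f. on_ar G (on_ar F f))\<rparr>"

definition is_nat_trans ::
  "('o, 'a) cat \<Rightarrow> ('p, 'b) cat \<Rightarrow> ('o, 'a, 'p, 'b) ftor \<Rightarrow> ('o, 'a, 'p, 'b) ftor
     \<Rightarrow> ('o \<Rightarrow> 'b) \<Rightarrow> bool" where
  "is_nat_trans K L F G \<tau> \<longleftrightarrow> is_functor K L F \<and> is_functor K L G \<and>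
     (\<forall>A \<in> Ob K. \<tau> A \<in> hom L (on_ob F A) (on_ob G A)) \<and>
     (\<forall>f \<in> Ar K. on_ar G f \<cdot>\<^bsub>L\<^esub> \<tau> (src K f) = \<tau> (tgt K f) \<cdot>\<^bsub>L\<^esub> on_ar F f)"

text \<open>
  \<open>adjunction K L F G \<eta> \<epsilon>\<close>: the functor \<open>F : L \<rightarrow> K\<close> is left adjoint to \<open>G : K \<rightarrow> L\<close>, with
  unit \<open>\<eta>\<close> and counit \<open>\<epsilon>\<close>.
\<close>

definition adjunction ::
  "('o, 'a) cat \<Rightarrow> ('p, 'b) cat \<Rightarrow> ('p, 'b, 'o, 'a) ftor \<Rightarrow> ('o, 'a, 'p, 'b) ftor
     \<Rightarrow> ('p \<Rightarrow> 'b) \<Rightarrow> ('o \<Rightarrow> 'a) \<Rightarrow> bool" where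
  "adjunction K L F G \<eta> \<epsilon> \<longleftrightarrow>
     is_functor L K F \<and> is_functor K L G \<and>
     is_nat_trans L L ftor_id (ftor_comp G F) \<eta> \<and>
     is_nat_trans K K (ftor_comp F G) ftor_id \<epsilon> \<and>
     (\<forall>A \<in> Ob L. \<epsilon> (on_ob F A) \<cdot>\<^bsub>K\<^esub> on_ar F (\<eta> A) = ide K (on_ob F A)) \<and>
     (\<forall>p \<in> Ob K. on_ar G (\<epsilon> p) \<cdot>\<^bsub>L\<^esub> \<eta> (on_ob G p) = ide L (on_ob G p))"

definition left_fixpoints :: "('o, 'a) cat \<Rightarrow> ('o \<Rightarrow> 'a) \<Rightarrow> 'o set" where
  "left_fixpoints K \<epsilon> = {p \<in> Ob K. is_iso K (\<epsilon> p)}"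

definition right_fixpoints :: "('p, 'b) cat \<Rightarrow> ('p \<Rightarrow> 'b) \<Rightarrow> 'p set" where
  "right_fixpoints L \<eta> = {A \<in> Ob L. is_iso L (\<eta> A)}"

definition adjoint_equivalence ::
  "('o, 'a) cat \<Rightarrow> ('p, 'b) cat \<Rightarrow> ('p, 'b, 'o, 'a) ftor \<Rightarrow> ('o, 'a, 'p, 'b) ftor
     \<Rightarrow> ('p \<Rightarrow> 'b) \<Rightarrow> ('o \<Rightarrow> 'a) \<Rightarrow> bool" where
  "adjoint_equivalence K L F G \<eta> \<epsilon> \<longleftrightarrow> adjunction K L F G \<eta> \<epsilon> \<and>
     (\<forall>A \<in> Ob L. is_iso L (\<eta> A)) \<and> (\<forall>p \<in> Ob K. is_iso K (\<epsilon> p))"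


section \<open>Size\<close>

text \<open>
  Arrows of the category, indices of atlases and elements of presheaves are all drawn from one
  type \<open>'m\<close>, which plays the part of the class of all mathematical objects; \<open>small\<close> singles out
  those subcollections of \<open>'m\<close> which count as sets.  Categories are locally small: the hom-sets
  are small, but neither the objects (of an arbitrary type \<open>'o\<close>) nor the arrows need form a set.
  Presheaves, and index sets of atlases, are small.  The distinction matters: if every subset
  of \<open>'m\<close> were allowed to index a local atlas, then Cantor's theorem would exclude all but
  degenerate categories with local glueings.  Examples: \<open>'m\<close> of inaccessible cardinality
  \<open>\<kappa>\<close> with \<open>small\<close> meaning of cardinality less than \<open>\<kappa>\<close> (the usual reading in a universe of
  sets), or \<open>'m\<close> countable with \<open>small\<close> meaning finite.
\<close>

definition smallness :: "('m set \<Rightarrow> bool) \<Rightarrow> bool" where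
  "smallness small \<longleftrightarrow> (\<forall>S T. small T \<and> S \<subseteq> T \<longrightarrow> small S)"

definition locally_small :: "('m set \<Rightarrow> bool) \<Rightarrow> ('o, 'm, 'z) cat_scheme \<Rightarrow> bool" where
  "locally_small small C \<longleftrightarrow> (\<forall>A \<in> Ob C. \<forall>B \<in> Ob C. small (hom C A B))"


section \<open>Join restriction categories\<close>

record ('o, 'm) rcat = "('o, 'm) cat" +
  rst :: "'m \<Rightarrow> 'm"

locale restriction_category = category C
  for C :: "('o, 'm, 'z) rcat_scheme" (structure) +
  assumes rst_hom: "f \<in> hom C A B \<Longrightarrow> rst C f \<in> hom C A A"
    and cmp_rst: "f \<in> hom C A B \<Longrightarrow> f \<cdot> rst C f = f"
    and rst_comm: "\<lbrakk>f \<in> hom C A B; g \<in> hom C A D\<rbrakk>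
                     \<Longrightarrow> rst C f \<cdot> rst C g = rst C g \<cdot> rst C f"
    and rst_cmp_rst: "\<lbrakk>f \<in> hom C A B; g \<in> hom C A D\<rbrakk>
                     \<Longrightarrow> rst C (g \<cdot> rst C f) = rst C g \<cdot> rst C f"
    and rst_cmp: "\<lbrakk>f \<in> hom C A B; g \<in> hom C B D\<rbrakk> \<Longrightarrow> rst C g \<cdot> f = f \<cdot> rst C (g \<cdot> f)"

definition rids :: "('o, 'm, 'z) rcat_scheme \<Rightarrow> 'o \<Rightarrow> 'm set" where
  "rids C A = {e \<in> hom C A A. rst C e = e}"

definition total :: "('o, 'm, 'z) rcat_scheme \<Rightarrow> 'm \<Rightarrow> bool" where
  "total C f \<longleftrightarrow> f \<in> Ar C \<and> rst C f = ide C (src C f)"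

definition rle :: "('o, 'm, 'z) rcat_scheme \<Rightarrow> 'm \<Rightarrow> 'm \<Rightarrow> bool" where
  "rle C f g \<longleftrightarrow> f = g \<cdot>\<^bsub>C\<^esub> rst C f"

definition compat :: "('o, 'm, 'z) rcat_scheme \<Rightarrow> 'm \<Rightarrow> 'm \<Rightarrow> bool" where
  "compat C f g \<longleftrightarrow> f \<cdot>\<^bsub>C\<^esub> rst C g = g \<cdot>\<^bsub>C\<^esub> rst C f"

definition is_lub_in :: "'x set \<Rightarrow> ('x \<Rightarrow> 'x \<Rightarrow> bool) \<Rightarrow> 'x set \<Rightarrow> 'x \<Rightarrow> bool" where
  "is_lub_in S le F j \<longleftrightarrow> j \<in> S \<and> (\<forall>f \<in> F. le f j) \<and>
     (\<forall>k \<in> S. (\<forall>f \<in> F. le f k) \<longrightarrow> le j k)"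

definition is_join :: "('o, 'm, 'z) rcat_scheme \<Rightarrow> 'o \<Rightarrow> 'o \<Rightarrow> 'm set \<Rightarrow> 'm \<Rightarrow> bool" where
  "is_join C A B F j \<longleftrightarrow> F \<subseteq> hom C A B \<and> is_lub_in (hom C A B) (rle C) F j"

definition join :: "('o, 'm, 'z) rcat_scheme \<Rightarrow> 'o \<Rightarrow> 'o \<Rightarrow> 'm set \<Rightarrow> 'm" where
  "join C A B F = (THE j. is_join C A B F j)"

locale join_restriction_category = restriction_category C
  for C :: "('o, 'm, 'z) rcat_scheme" (structure) +
  assumes join_ex: "\<lbrakk>A \<in> Ob C; B \<in> Ob C; F \<subseteq> hom C A B; \<forall>f \<in> F. \<forall>g \<in> F. compat C f g\<rbrakk>
                      \<Longrightarrow> \<exists>j. is_join C A B F j"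
    and join_precomp: "\<lbrakk>is_join C A B F j; \<forall>f \<in> F. \<forall>g \<in> F. compat C f g; h \<in> hom C A' A\<rbrakk>
                      \<Longrightarrow> is_join C A' B ((\<lambda>f. f \<cdot> h) ` F) (j \<cdot> h)"

definition partial_inverse :: "('o, 'm, 'z) rcat_scheme \<Rightarrow> 'm \<Rightarrow> 'm \<Rightarrow> bool" where
  "partial_inverse C s t \<longleftrightarrow> s \<in> Ar C \<and> t \<in> hom C (tgt C s) (src C s) \<and>
     t \<cdot>\<^bsub>C\<^esub> s = rst C s \<and> s \<cdot>\<^bsub>C\<^esub> t = rst C t"

definition partial_iso :: "('o, 'm, 'z) rcat_scheme \<Rightarrow> 'm \<Rightarrow> bool" where
  "partial_iso C s \<longleftrightarrow> (\<exists>t. partial_inverse C s t)"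

definition local_homeo :: "('o, 'm, 'z) rcat_scheme \<Rightarrow> 'm \<Rightarrow> bool" where
  "local_homeo C p \<longleftrightarrow> total C p \<and>
     (\<exists>F. (\<forall>f \<in> F. partial_iso C f) \<and> is_join C (src C p) (tgt C p) F p)"

definition local_atlas ::
  "('o, 'm, 'z) rcat_scheme \<Rightarrow> 'o \<Rightarrow> 'i set \<Rightarrow> ('i \<Rightarrow> 'i \<Rightarrow> 'm) \<Rightarrow> bool" where
  "local_atlas C X I \<phi> \<longleftrightarrow>
     (\<forall>i \<in> I. \<forall>j \<in> I. \<phi> i j \<in> rids C X \<and> \<phi> i j = \<phi> j i) \<and>
     (\<forall>i \<in> I. \<forall>j \<in> I. \<forall>k \<in> I. rle C (\<phi> j k \<cdot>\<^bsub>C\<^esub> \<phi> i j) (\<phi> i k))"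

text \<open>A glueing \<open>p = \<Or>\<^sub>i p\<^sub>i\<close>, recorded with its \<open>p\<^sub>i\<close> and their partial inverses \<open>s\<^sub>i\<close>.\<close>

record ('i, 'm) glueing =
  glue_map :: "'m"
  chart :: "'i \<Rightarrow> 'm"
  sect :: "'i \<Rightarrow> 'm"

definition is_glueing ::
  "('o, 'm, 'z) rcat_scheme \<Rightarrow> 'o \<Rightarrow> 'i set \<Rightarrow> ('i \<Rightarrow> 'i \<Rightarrow> 'm) \<Rightarrow> ('i, 'm) glueing \<Rightarrow> bool" where
  "is_glueing C X I \<phi> G \<longleftrightarrow>
     local_homeo C (glue_map G) \<and> tgt C (glue_map G) = X \<and>
     is_join C (src C (glue_map G)) X (chart G ` I) (glue_map G) \<and>
     (\<forall>i \<in> I. partial_inverse C (chart G i) (sect G i)) \<and>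
     (\<forall>i \<in> I. \<forall>j \<in> I. \<phi> i j = chart G j \<cdot>\<^bsub>C\<^esub> sect G i)"

definition has_local_glueings ::
  "('i set \<Rightarrow> bool) \<Rightarrow> ('o, 'm, 'z) rcat_scheme \<Rightarrow> bool" where
  "has_local_glueings small C \<longleftrightarrow>
     (\<forall>X \<in> Ob C. \<forall>I \<phi>. small I \<and> local_atlas C X I \<phi> \<longrightarrow> (\<exists>G. is_glueing C X I \<phi> G))"


section \<open>Slices\<close>

text \<open>An arrow \<open>p \<rightarrow> q\<close> of the slice is a triple \<open>(p, f, q)\<close>, so as to have a definite target.\<close>

definition total_slice :: "('o, 'm, 'z) rcat_scheme \<Rightarrow> 'o \<Rightarrow> ('m, 'm \<times> 'm \<times> 'm) cat" where
  "total_slice C X = \<lparr>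
     Ob = {p. total C p \<and> tgt C p = X},
     Ar = {(p, f, q). total C p \<and> tgt C p = X \<and> total C q \<and> tgt C q = X \<and>
                      f \<in> hom C (src C p) (src C q) \<and> q \<cdot>\<^bsub>C\<^esub> f = p},
     src = (\<lambda>(p, f, q). p),
     tgt = (\<lambda>(p, f, q). q),
     ide = (\<lambda>p. (p, ide C (src C p), p)),
     cmp = (\<lambda>(q', g, r) (p, f, q). (p, g \<cdot>\<^bsub>C\<^esub> f, r))\<rparr>"

definition lh_slice :: "('o, 'm, 'z) rcat_scheme \<Rightarrow> 'o \<Rightarrow> ('m, 'm \<times> 'm \<times> 'm) cat" where
  "lh_slice C X = full_subcat (total_slice C X) (local_homeo C)"


section \<open>Presheaves and sheaves\<close>

record ('e, 'm) psh =
  carrier :: "'e set"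
  act :: "'e \<Rightarrow> 'm \<Rightarrow> 'e"
  extent :: "'e \<Rightarrow> 'm"

definition presheaf ::
  "('e set \<Rightarrow> bool) \<Rightarrow> ('o, 'm, 'z) rcat_scheme \<Rightarrow> 'o \<Rightarrow> ('e, 'm) psh \<Rightarrow> bool" where
  "presheaf small C X A \<longleftrightarrow> small (carrier A) \<and>
     (\<forall>a \<in> carrier A. \<forall>e \<in> rids C X. act A a e \<in> carrier A) \<and>
     (\<forall>a \<in> carrier A. act A a (ide C X) = a) \<and>
     (\<forall>a \<in> carrier A. \<forall>d \<in> rids C X. \<forall>e \<in> rids C X. act A (act A a d) e = act A a (d \<cdot>\<^bsub>C\<^esub> e)) \<and>
     (\<forall>a \<in> carrier A. extent A a \<in> rids C X) \<and>
     (\<forall>a \<in> carrier A. act A a (extent A a) = a) \<and>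
     (\<forall>a \<in> carrier A. \<forall>e \<in> rids C X. extent A (act A a e) = extent A a \<cdot>\<^bsub>C\<^esub> e)"

definition psh_le :: "('e, 'm) psh \<Rightarrow> 'e \<Rightarrow> 'e \<Rightarrow> bool" where
  "psh_le A a b \<longleftrightarrow> a = act A b (extent A a)"

definition psh_compat :: "('e, 'm) psh \<Rightarrow> 'e \<Rightarrow> 'e \<Rightarrow> bool" where
  "psh_compat A a b \<longleftrightarrow> act A a (extent A b) = act A b (extent A a)"

definition sheaf_cond :: "('e, 'm) psh \<Rightarrow> bool" where
  "sheaf_cond A \<longleftrightarrow>
     (\<forall>F \<subseteq> carrier A. (\<forall>a \<in> F. \<forall>b \<in> F. psh_compat A a b) \<longrightarrow>
        (\<exists>j. is_lub_in (carrier A) (psh_le A) F j))"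

text \<open>A map of presheaves is a triple \<open>(A, f, B)\<close> with \<open>f\<close> undefined outside the carrier of \<open>A\<close>.\<close>

definition Psh :: "('e set \<Rightarrow> bool) \<Rightarrow> ('o, 'm, 'z) rcat_scheme \<Rightarrow> 'o \<Rightarrow>
    (('e, 'm) psh, ('e, 'm) psh \<times> ('e \<Rightarrow> 'e) \<times> ('e, 'm) psh) cat" where
  "Psh small C X = \<lparr>
     Ob = {A. presheaf small C X A},
     Ar = {(A, f, B). presheaf small C X A \<and> presheaf small C X B \<and>
             f \<in> carrier A \<rightarrow>\<^sub>E carrier B \<and>
             (\<forall>a \<in> carrier A. \<forall>e \<in> rids C X. f (act A a e) = act B (f a) e) \<and>
             (\<forall>a \<in> carrier A. extent B (f a) = extent A a)},
     src = (\<lambda>(A, f, B). A),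
     tgt = (\<lambda>(A, f, B). B),
     ide = (\<lambda>A. (A, \<lambda>a \<in> carrier A. a, A)),
     cmp = (\<lambda>(B', g, D) (A, f, B). (A, compose (carrier A) g f, D))\<rparr>"

definition Sh :: "('e set \<Rightarrow> bool) \<Rightarrow> ('o, 'm, 'z) rcat_scheme \<Rightarrow> 'o \<Rightarrow>
    (('e, 'm) psh, ('e, 'm) psh \<times> ('e \<Rightarrow> 'e) \<times> ('e, 'm) psh) cat" where
  "Sh small C X = full_subcat (Psh small C X) sheaf_cond"


section \<open>The functors \<open>\<Gamma>\<close> and \<open>\<Delta>\<close>\<close>

definition partial_sections :: "('o, 'm, 'z) rcat_scheme \<Rightarrow> 'm \<Rightarrow> 'm set" where
  "partial_sections C p = {s \<in> hom C (tgt C p) (src C p). p \<cdot>\<^bsub>C\<^esub> s = rst C s}"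

definition Gamma_ob :: "('o, 'm, 'z) rcat_scheme \<Rightarrow> 'm \<Rightarrow> ('m, 'm) psh" where
  "Gamma_ob C p = \<lparr>carrier = partial_sections C p, act = (\<lambda>s e. s \<cdot>\<^bsub>C\<^esub> e), extent = rst C\<rparr>"

definition Gamma :: "('o, 'm, 'z) rcat_scheme \<Rightarrow>
    ('m, 'm \<times> 'm \<times> 'm, ('m, 'm) psh, ('m, 'm) psh \<times> ('m \<Rightarrow> 'm) \<times> ('m, 'm) psh) ftor" where
  "Gamma C = \<lparr>
     on_ob = Gamma_ob C,
     on_ar = (\<lambda>(p, f, q). (Gamma_ob C p, \<lambda>s \<in> partial_sections C p. f \<cdot>\<^bsub>C\<^esub> s, Gamma_ob C q))\<rparr>"

definition agree :: "('o, 'm, 'z) rcat_scheme \<Rightarrow> 'o \<Rightarrow> ('e, 'm) psh \<Rightarrow> 'e \<Rightarrow> 'e \<Rightarrow> 'm" where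
  "agree C X A a b = join C X X
     {e \<in> rids C X. rle C e (extent A a \<cdot>\<^bsub>C\<^esub> extent A b) \<and> act A a e = act A b e}"

text \<open>
  \<open>\<Delta>\<close> depends on a choice \<open>gl\<close> of a glueing for each presheaf.
\<close>

definition glueing_choice :: "('m set \<Rightarrow> bool) \<Rightarrow> ('o, 'm, 'z) rcat_scheme \<Rightarrow> 'o \<Rightarrow>
    (('m, 'm) psh \<Rightarrow> ('m, 'm) glueing) \<Rightarrow> bool" where
  "glueing_choice small C X gl \<longleftrightarrow>
     (\<forall>A. presheaf small C X A \<longrightarrow> is_glueing C X (carrier A) (agree C X A) (gl A))"

definition Delta_ob :: "(('m, 'm) psh \<Rightarrow> ('m, 'm) glueing) \<Rightarrow> ('m, 'm) psh \<Rightarrow> 'm" where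
  "Delta_ob gl A = glue_map (gl A)"

definition unit_map :: "('o, 'm, 'z) rcat_scheme \<Rightarrow> (('m, 'm) psh \<Rightarrow> ('m, 'm) glueing) \<Rightarrow>
    ('m, 'm) psh \<Rightarrow> ('m, 'm) psh \<times> ('m \<Rightarrow> 'm) \<times> ('m, 'm) psh" where
  "unit_map C gl A = (A, \<lambda>a \<in> carrier A. sect (gl A) a, Gamma_ob C (Delta_ob gl A))"

text \<open>
  The action of \<open>\<Delta>\<close> on maps, and the counit, are those determined by \<open>\<Gamma>\<close>, the object part of
  \<open>\<Delta>\<close> and the unit: \<open>\<Delta> f\<close> is the unique map with \<open>\<Gamma> (\<Delta> f) \<circ> \<eta>\<^sub>A = \<eta>\<^sub>B \<circ> f\<close>, and \<open>\<epsilon>\<^sub>p\<close> the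
  unique map \<open>\<Delta> \<Gamma> p \<rightarrow> p\<close> with \<open>\<Gamma> \<epsilon>\<^sub>p \<circ> \<eta>\<^bsub>\<Gamma> p\<^esub> = 1\<close>.
\<close>

definition Delta :: "('m set \<Rightarrow> bool) \<Rightarrow> ('o, 'm, 'z) rcat_scheme \<Rightarrow> 'o \<Rightarrow>
    (('m, 'm) psh \<Rightarrow> ('m, 'm) glueing) \<Rightarrow>
    (('m, 'm) psh, ('m, 'm) psh \<times> ('m \<Rightarrow> 'm) \<times> ('m, 'm) psh, 'm, 'm \<times> 'm \<times> 'm) ftor" where
  "Delta small C X gl = \<lparr>
     on_ob = Delta_ob gl,
     on_ar = (\<lambda>(A, f, B). THE h. h \<in> hom (total_slice C X) (Delta_ob gl A) (Delta_ob gl B) \<and>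
       on_ar (Gamma C) h \<cdot>\<^bsub>Psh small C X\<^esub> unit_map C gl A
         = unit_map C gl B \<cdot>\<^bsub>Psh small C X\<^esub> (A, f, B))\<rparr>"

definition counit_map :: "('m set \<Rightarrow> bool) \<Rightarrow> ('o, 'm, 'z) rcat_scheme \<Rightarrow> 'o \<Rightarrow>
    (('m, 'm) psh \<Rightarrow> ('m, 'm) glueing) \<Rightarrow> 'm \<Rightarrow> 'm \<times> 'm \<times> 'm" where
  "counit_map small C X gl p =
     (THE h. h \<in> hom (total_slice C X) (Delta_ob gl (Gamma_ob C p)) p \<and>
       on_ar (Gamma C) h \<cdot>\<^bsub>Psh small C X\<^esub> unit_map C gl (Gamma_ob C p)
         = ide (Psh small C X) (Gamma_ob C p))"

end

(* Sections of a local homeomorphism p with charts c_i and partial inverses s_i are determined locally: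
   a section t agrees with s_i on the idempotent c_i t, and these idempotents join to the restriction
   of t. Hence a map h out of p is the same thing as a family of values h s_i that is compatible on the
   overlaps c_i s_j. For the glueing of the atlas of a presheaf A these families are exactly the
   presheaf maps out of A, which makes the unit a universal arrow and gives the adjunction. If p is a
   local homeomorphism, the family of the sections of the glueing of Gamma p that are named by the s_i
   defines an inverse to the counit. If A is a sheaf, each partial section t of its glueing is
   recovered by joining the restrictions of the elements a to the idempotents on which t agrees
   with the section named by a, so the unit is bijective. *)

theory Submission
  imports Defs
begin

section \<open>Adjunctions\<close>

text \<open>The agreement idempotent \<open>agree C X A a b\<close> is a join of idempotents on
  which \<open>a\<close> and \<open>b\<close> coincide, but in a general presheaf the elements need
  not coincide on that join. In the category equality does pass to joins, once postcomposition is
  shown to preserve them. Hence elements are compared through the sections that name them, or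
  through their images in some \<open>Gamma_ob C q\<close>, and the sheaf condition is what brings
  equality back to the elements. This fixes an order: injectivity of the unit comes before
  surjectivity, because the pieces to be joined there are shown compatible by comparing their
  sections. \<open>Delta\<close> on maps and the counit are definite descriptions, so unique
  existence in the universal property of the unit has to precede every statement about them; the
  rest of the adjunction follows formally from uniqueness. Passing to fixpoints is formal too: each
  triangle identity presents a component of the counit or unit as a one-sided inverse of the image
  of an isomorphism.\<close>

context category
begin

lemma hom_iff: "f \<in> hom C A B \<longleftrightarrow> f \<in> Ar C \<and> src C f = A \<and> tgt C f = B"
  by (auto simp: hom_def)

lemma homI: "f \<in> Ar C \<Longrightarrow> f \<in> hom C (src C f) (tgt C f)"
  by (simp add: hom_iff)

lemma hom_Ob: "f \<in> hom C A B \<Longrightarrow> A \<in> Ob C \<and> B \<in> Ob C"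
  using src_Ob tgt_Ob by (auto simp: hom_iff)

lemma cmp_Ar [simp]: "\<lbrakk>f \<in> Ar C; g \<in> Ar C; src C g = tgt C f\<rbrakk> \<Longrightarrow> g \<cdot> f \<in> Ar C"
  and src_cmp [simp]: "\<lbrakk>f \<in> Ar C; g \<in> Ar C; src C g = tgt C f\<rbrakk> \<Longrightarrow> src C (g \<cdot> f) = src C f"
  and tgt_cmp [simp]: "\<lbrakk>f \<in> Ar C; g \<in> Ar C; src C g = tgt C f\<rbrakk> \<Longrightarrow> tgt C (g \<cdot> f) = tgt C g"
  using cmp_hom[of f "src C f" "tgt C f" g "tgt C g"] by (auto simp: hom_iff)

lemma cmp_cmp:
  "\<lbrakk>f \<in> Ar C; g \<in> Ar C; h \<in> Ar C; src C g = tgt C f; src C h = tgt C g\<rbrakk>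
    \<Longrightarrow> (h \<cdot> g) \<cdot> f = h \<cdot> (g \<cdot> f)"
  using cmp_assoc[of f "src C f" "tgt C f" g "tgt C g" h "tgt C h"] by (auto simp: hom_iff)

lemma ide_Ar [simp]: "A \<in> Ob C \<Longrightarrow> ide C A \<in> Ar C"
  and src_ide [simp]: "A \<in> Ob C \<Longrightarrow> src C (ide C A) = A"
  and tgt_ide [simp]: "A \<in> Ob C \<Longrightarrow> tgt C (ide C A) = A"
  using ide_hom[of A] by (auto simp: hom_iff)

lemma cmp_ide [simp]: "\<lbrakk>f \<in> Ar C; src C f = A\<rbrakk> \<Longrightarrow> f \<cdot> ide C A = f"
  and ide_cmp [simp]: "\<lbrakk>f \<in> Ar C; tgt C f = B\<rbrakk> \<Longrightarrow> ide C B \<cdot> f = f"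
  using cmp_ide_right[of f A] cmp_ide_left[of f _ B] by (auto simp: hom_iff)

lemma is_isoI:
  assumes "f \<in> hom C A B" "g \<in> hom C B A" "g \<cdot> f = ide C A" "f \<cdot> g = ide C B"
  shows "is_iso C f"
  using assms by (auto simp: is_iso_def hom_iff)

lemma is_isoE:
  assumes "is_iso C f" "f \<in> hom C A B"
  obtains g where "g \<in> hom C B A" "g \<cdot> f = ide C A" "f \<cdot> g = ide C B"
  using assms by (auto simp: is_iso_def hom_iff)

text \<open>In the triangle identity at the left adjoint a counit component retracts the image of a
  unit component. When that image \<open>f\<close> is invertible, inserting
  \<open>f \<cdot> g\<close> after the retraction identifies it with the inverse
  \<open>g\<close>.\<close>

lemma retraction_of_iso_is_iso:
  assumes f: "is_iso C f" "f \<in> hom C A B" and e: "e \<in> hom C B A" "e \<cdot> f = ide C A"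
  shows "is_iso C e"
proof -
  obtain g where g: "g \<in> hom C B A" "g \<cdot> f = ide C A" "f \<cdot> g = ide C B"
    using f by (rule is_isoE)
  have "e = e \<cdot> (f \<cdot> g)" using e(1) g(3) by (simp add: hom_iff)
  also have "\<dots> = (e \<cdot> f) \<cdot> g" using cmp_assoc[OF g(1) f(2) e(1)] .
  also have "\<dots> = g" using e(2) g(1) by (simp add: hom_iff)
  finally show ?thesis using g f by (auto intro: is_isoI)
qed

text \<open>Dual to the preceding cancellation, for the triangle identity in which a unit component
  is a section of the image of a counit component.\<close>

lemma section_of_iso_is_iso:
  assumes f: "is_iso C f" "f \<in> hom C A B" and e: "e \<in> hom C B A" "f \<cdot> e = ide C B"
  shows "is_iso C e"
proof -
  obtain g where g: "g \<in> hom C B A" "g \<cdot> f = ide C A" "f \<cdot> g = ide C B"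
    using f by (rule is_isoE)
  have "e = (g \<cdot> f) \<cdot> e" using e(1) g(2) by (simp add: hom_iff)
  also have "\<dots> = g \<cdot> (f \<cdot> e)" using cmp_assoc[OF e(1) f(2) g(1)] by simp
  also have "\<dots> = g" using e(2) g(1) by (simp add: hom_iff)
  finally show ?thesis using g f by (auto intro: is_isoI)
qed

end

lemma is_functor_iso:
  assumes F: "is_functor K L F" and f: "is_iso K f"
  shows "is_iso L (on_ar F f)"
proof -
  interpret K: category K using F by (simp add: is_functor_def)
  interpret L: category L using F by (simp add: is_functor_def)
  have fA: "f \<in> Ar K" using f by (simp add: is_iso_def)
  obtain g where g: "g \<in> hom K (tgt K f) (src K f)" "g \<cdot>\<^bsub>K\<^esub> f = ide K (src K f)"
      "f \<cdot>\<^bsub>K\<^esub> g = ide K (tgt K f)"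
    using f by (auto simp: is_iso_def)
  have gf: "on_ar F (g \<cdot>\<^bsub>K\<^esub> f) = on_ar F g \<cdot>\<^bsub>L\<^esub> on_ar F f"
    and fg: "on_ar F (f \<cdot>\<^bsub>K\<^esub> g) = on_ar F f \<cdot>\<^bsub>L\<^esub> on_ar F g"
    using F g(1) fA by (auto simp: is_functor_def K.hom_iff)
  have "on_ar F f \<in> hom L (on_ob F (src K f)) (on_ob F (tgt K f))"
    and "on_ar F g \<in> hom L (on_ob F (tgt K f)) (on_ob F (src K f))"
    and "on_ar F (ide K (src K f)) = ide L (on_ob F (src K f))"
    and "on_ar F (ide K (tgt K f)) = ide L (on_ob F (tgt K f))"
    using F g(1) fA K.src_Ob K.tgt_Ob by (auto simp: is_functor_def K.hom_iff)
  then show ?thesis using g(2,3) gf fg L.is_isoI by metis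
qed

lemma is_functor_comp:
  assumes F: "is_functor K L F" and G: "is_functor L M G"
  shows "is_functor K M (ftor_comp G F)"
  unfolding is_functor_def ftor_comp_def ftor.simps
proof (intro conjI ballI impI)
  interpret L: category L using G by (simp add: is_functor_def)
  have F_ar: "on_ar F f \<in> hom L (on_ob F (src K f)) (on_ob F (tgt K f))" if "f \<in> Ar K" for f
    using F that by (simp add: is_functor_def)
  show "on_ar G (on_ar F f) \<in> hom M (on_ob G (on_ob F (src K f))) (on_ob G (on_ob F (tgt K f)))"
    if "f \<in> Ar K" for f
    using F_ar[OF that] G by (auto simp: is_functor_def L.hom_iff)
  show "on_ar G (on_ar F (g \<cdot>\<^bsub>K\<^esub> f)) = on_ar G (on_ar F g) \<cdot>\<^bsub>M\<^esub> on_ar G (on_ar F f)"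
    if "f \<in> Ar K" "g \<in> Ar K" "tgt K f = src K g" for f g
    using F_ar[OF that(1)] F_ar[OF that(2)] F G that by (auto simp: is_functor_def L.hom_iff)
qed (use F G in \<open>auto simp: is_functor_def\<close>)

text \<open>Existence of the transposes that matter is already packed into the data
  \<open>on_ar F\<close> and \<open>\<epsilon>\<close>, so \<open>univ\<close> asks only for
  uniqueness. Functoriality of \<open>F\<close>, naturality of \<open>\<epsilon>\<close> and the
  remaining triangle identity are equations between maps out of some \<open>on_ob F A\<close>, and
  they hold because both sides have the same transpose.\<close>

lemma universal_arrows_adjunction:
  assumes G: "is_functor K L G" and L: "category L"
    and F_ob: "\<And>A. A \<in> Ob L \<Longrightarrow> on_ob F A \<in> Ob K"
    and eta: "\<And>A. A \<in> Ob L \<Longrightarrow> \<eta> A \<in> hom L A (on_ob G (on_ob F A))"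
    and univ: "\<And>A p h k. \<lbrakk>A \<in> Ob L; h \<in> hom K (on_ob F A) p; k \<in> hom K (on_ob F A) p;
                 on_ar G h \<cdot>\<^bsub>L\<^esub> \<eta> A = on_ar G k \<cdot>\<^bsub>L\<^esub> \<eta> A\<rbrakk> \<Longrightarrow> h = k"
    and F_ar: "\<And>f. f \<in> Ar L \<Longrightarrow> on_ar F f \<in> hom K (on_ob F (src L f)) (on_ob F (tgt L f))"
    and F_nat: "\<And>f. f \<in> Ar L \<Longrightarrow> on_ar G (on_ar F f) \<cdot>\<^bsub>L\<^esub> \<eta> (src L f) = \<eta> (tgt L f) \<cdot>\<^bsub>L\<^esub> f"
    and eps: "\<And>p. p \<in> Ob K \<Longrightarrow> \<epsilon> p \<in> hom K (on_ob F (on_ob G p)) p"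
    and eps_eta: "\<And>p. p \<in> Ob K \<Longrightarrow> on_ar G (\<epsilon> p) \<cdot>\<^bsub>L\<^esub> \<eta> (on_ob G p) = ide L (on_ob G p)"
  shows "adjunction K L F G \<eta> \<epsilon>"
proof -
  interpret K: category K using G by (simp add: is_functor_def)
  interpret L: category L by (fact L)
  have G_ob: "p \<in> Ob K \<Longrightarrow> on_ob G p \<in> Ob L"
    and G_hom: "f \<in> hom K p q \<Longrightarrow> on_ar G f \<in> hom L (on_ob G p) (on_ob G q)"
    and G_ide: "p \<in> Ob K \<Longrightarrow> on_ar G (ide K p) = ide L (on_ob G p)"
    and G_cmp: "\<lbrakk>f \<in> hom K p q; g \<in> hom K q r\<rbrakk> \<Longrightarrow> on_ar G (g \<cdot>\<^bsub>K\<^esub> f) = on_ar G g \<cdot>\<^bsub>L\<^esub> on_ar G f"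
    for p q r f g
    using G by (auto simp: is_functor_def K.hom_iff)
  have F_hom: "on_ar F f \<in> hom K (on_ob F A) (on_ob F B)"
    and F_hom_nat: "on_ar G (on_ar F f) \<cdot>\<^bsub>L\<^esub> \<eta> A = \<eta> B \<cdot>\<^bsub>L\<^esub> f"
    if "f \<in> hom L A B" for f A B
    using that F_ar[of f] F_nat[of f] by (auto simp: L.hom_iff)
  have G_cmp_eta: "on_ar G (g \<cdot>\<^bsub>K\<^esub> f) \<cdot>\<^bsub>L\<^esub> \<eta> A = on_ar G g \<cdot>\<^bsub>L\<^esub> (on_ar G f \<cdot>\<^bsub>L\<^esub> \<eta> A)"
    if "f \<in> hom K (on_ob F A) q" "g \<in> hom K q r" "A \<in> Ob L" for f g A q r
    using G_cmp[OF that(1,2)] L.cmp_assoc[OF eta[OF that(3)] G_hom[OF that(1)] G_hom[OF that(2)]]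
    by simp
  have F_ide: "on_ar F (ide L A) = ide K (on_ob F A)" if A: "A \<in> Ob L" for A
  proof (rule univ[OF A])
    show "on_ar F (ide L A) \<in> hom K (on_ob F A) (on_ob F A)"
      using F_hom[OF L.ide_hom[OF A]] .
    show "ide K (on_ob F A) \<in> hom K (on_ob F A) (on_ob F A)"
      using K.ide_hom[OF F_ob[OF A]] .
    show "on_ar G (on_ar F (ide L A)) \<cdot>\<^bsub>L\<^esub> \<eta> A = on_ar G (ide K (on_ob F A)) \<cdot>\<^bsub>L\<^esub> \<eta> A"
      using F_hom_nat[OF L.ide_hom[OF A]] G_ide[OF F_ob[OF A]] eta[OF A]
      by (auto simp: L.hom_iff)
  qed
  have F_cmp: "on_ar F (g \<cdot>\<^bsub>L\<^esub> f) = on_ar F g \<cdot>\<^bsub>K\<^esub> on_ar F f"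
    if f: "f \<in> hom L A B" and g: "g \<in> hom L B D" for f g A B D
  proof -
    have Ob: "A \<in> Ob L" "B \<in> Ob L" "D \<in> Ob L"
      using L.hom_Ob f g by auto
    show ?thesis
    proof (rule univ[OF Ob(1)])
      show "on_ar F (g \<cdot>\<^bsub>L\<^esub> f) \<in> hom K (on_ob F A) (on_ob F D)"
        using F_hom[OF L.cmp_hom[OF f g]] .
      show "on_ar F g \<cdot>\<^bsub>K\<^esub> on_ar F f \<in> hom K (on_ob F A) (on_ob F D)"
        using K.cmp_hom[OF F_hom[OF f] F_hom[OF g]] .
      have "on_ar G (on_ar F g \<cdot>\<^bsub>K\<^esub> on_ar F f) \<cdot>\<^bsub>L\<^esub> \<eta> A
          = on_ar G (on_ar F g) \<cdot>\<^bsub>L\<^esub> (\<eta> B \<cdot>\<^bsub>L\<^esub> f)"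
        using G_cmp_eta[OF F_hom[OF f] F_hom[OF g] Ob(1)] F_hom_nat[OF f] by simp
      also have "\<dots> = (\<eta> D \<cdot>\<^bsub>L\<^esub> g) \<cdot>\<^bsub>L\<^esub> f"
        using L.cmp_assoc[OF f eta[OF Ob(2)] G_hom[OF F_hom[OF g]]] F_hom_nat[OF g] by simp
      also have "\<dots> = \<eta> D \<cdot>\<^bsub>L\<^esub> (g \<cdot>\<^bsub>L\<^esub> f)"
        using L.cmp_assoc[OF f g eta[OF Ob(3)]] by simp
      finally show "on_ar G (on_ar F (g \<cdot>\<^bsub>L\<^esub> f)) \<cdot>\<^bsub>L\<^esub> \<eta> A
          = on_ar G (on_ar F g \<cdot>\<^bsub>K\<^esub> on_ar F f) \<cdot>\<^bsub>L\<^esub> \<eta> A"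
        using F_hom_nat[OF L.cmp_hom[OF f g]] by simp
    qed
  qed
  have F: "is_functor L K F"
    unfolding is_functor_def
  proof (intro conjI ballI impI)
    fix f g assume "f \<in> Ar L" "g \<in> Ar L" "tgt L f = src L g"
    then show "on_ar F (g \<cdot>\<^bsub>L\<^esub> f) = on_ar F g \<cdot>\<^bsub>K\<^esub> on_ar F f"
      using F_cmp by (simp add: L.hom_iff)
  qed (use F_ob F_ar F_ide in \<open>auto intro: K.category_axioms L.category_axioms\<close>)
  have idL: "is_functor L L ftor_id" and idK: "is_functor K K ftor_id"
    by (auto simp: is_functor_def ftor_id_def L.homI K.homI
        intro: K.category_axioms L.category_axioms)
  have GF: "is_functor L L (ftor_comp G F)" and FG: "is_functor K K (ftor_comp F G)"
    using is_functor_comp F G by blast+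
  have nat_eta: "is_nat_trans L L ftor_id (ftor_comp G F) \<eta>"
    using idL GF eta F_nat by (auto simp: is_nat_trans_def ftor_id_def ftor_comp_def)
  have eps_nat: "f \<cdot>\<^bsub>K\<^esub> \<epsilon> p = \<epsilon> q \<cdot>\<^bsub>K\<^esub> on_ar F (on_ar G f)" if f: "f \<in> hom K p q" for f p q
  proof -
    have Ob: "p \<in> Ob K" "q \<in> Ob K" using K.hom_Ob f by auto
    note GOb = G_ob[OF Ob(1)] G_ob[OF Ob(2)]
    show ?thesis
    proof (rule univ[OF GOb(1)])
      show "f \<cdot>\<^bsub>K\<^esub> \<epsilon> p \<in> hom K (on_ob F (on_ob G p)) q"
        using K.cmp_hom[OF eps[OF Ob(1)] f] .
      show "\<epsilon> q \<cdot>\<^bsub>K\<^esub> on_ar F (on_ar G f) \<in> hom K (on_ob F (on_ob G p)) q"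
        using K.cmp_hom[OF F_hom[OF G_hom[OF f]] eps[OF Ob(2)]] .
      have "on_ar G (f \<cdot>\<^bsub>K\<^esub> \<epsilon> p) \<cdot>\<^bsub>L\<^esub> \<eta> (on_ob G p) = on_ar G f"
        using G_cmp_eta[OF eps[OF Ob(1)] f GOb(1)] eps_eta[OF Ob(1)] G_hom[OF f]
        by (auto simp: L.hom_iff)
      moreover have "on_ar G (\<epsilon> q \<cdot>\<^bsub>K\<^esub> on_ar F (on_ar G f)) \<cdot>\<^bsub>L\<^esub> \<eta> (on_ob G p)
          = on_ar G (\<epsilon> q) \<cdot>\<^bsub>L\<^esub> (\<eta> (on_ob G q) \<cdot>\<^bsub>L\<^esub> on_ar G f)"
        using G_cmp_eta[OF F_hom[OF G_hom[OF f]] eps[OF Ob(2)] GOb(1)] F_hom_nat[OF G_hom[OF f]]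
        by simp
      moreover have "\<dots> = (on_ar G (\<epsilon> q) \<cdot>\<^bsub>L\<^esub> \<eta> (on_ob G q)) \<cdot>\<^bsub>L\<^esub> on_ar G f"
        using L.cmp_assoc[OF G_hom[OF f] eta[OF GOb(2)] G_hom[OF eps[OF Ob(2)]]] .
      moreover have "\<dots> = on_ar G f"
        using eps_eta[OF Ob(2)] G_hom[OF f] by (auto simp: L.hom_iff)
      ultimately show "on_ar G (f \<cdot>\<^bsub>K\<^esub> \<epsilon> p) \<cdot>\<^bsub>L\<^esub> \<eta> (on_ob G p)
          = on_ar G (\<epsilon> q \<cdot>\<^bsub>K\<^esub> on_ar F (on_ar G f)) \<cdot>\<^bsub>L\<^esub> \<eta> (on_ob G p)" by simp
    qed
  qed
  have nat_eps: "is_nat_trans K K (ftor_comp F G) ftor_id \<epsilon>"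
    using idK FG eps eps_nat by (auto simp: is_nat_trans_def ftor_id_def ftor_comp_def K.hom_iff)
  have triangle: "\<epsilon> (on_ob F A) \<cdot>\<^bsub>K\<^esub> on_ar F (\<eta> A) = ide K (on_ob F A)" if A: "A \<in> Ob L" for A
  proof -
    note FA = F_ob[OF A] and GFA = G_ob[OF F_ob[OF A]]
    note e = eps[OF FA] and n = F_hom[OF eta[OF A]]
    show ?thesis
    proof (rule univ[OF A])
      show "\<epsilon> (on_ob F A) \<cdot>\<^bsub>K\<^esub> on_ar F (\<eta> A) \<in> hom K (on_ob F A) (on_ob F A)"
        using K.cmp_hom[OF n e] .
      show "ide K (on_ob F A) \<in> hom K (on_ob F A) (on_ob F A)"
        using K.ide_hom[OF FA] .
      \<comment> \<open>By naturality of \<open>\<eta>\<close> and the triangle identity that is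
        given, both sides transpose to \<open>\<eta> A\<close>.\<close>
      have "on_ar G (\<epsilon> (on_ob F A) \<cdot>\<^bsub>K\<^esub> on_ar F (\<eta> A)) \<cdot>\<^bsub>L\<^esub> \<eta> A
          = on_ar G (\<epsilon> (on_ob F A)) \<cdot>\<^bsub>L\<^esub> (\<eta> (on_ob G (on_ob F A)) \<cdot>\<^bsub>L\<^esub> \<eta> A)"
        using G_cmp_eta[OF n e A] F_hom_nat[OF eta[OF A]] by simp
      also have "\<dots> = ide L (on_ob G (on_ob F A)) \<cdot>\<^bsub>L\<^esub> \<eta> A"
        using L.cmp_assoc[OF eta[OF A] eta[OF GFA] G_hom[OF e]] eps_eta[OF FA] by simp
      finally show "on_ar G (\<epsilon> (on_ob F A) \<cdot>\<^bsub>K\<^esub> on_ar F (\<eta> A)) \<cdot>\<^bsub>L\<^esub> \<eta> A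
          = on_ar G (ide K (on_ob F A)) \<cdot>\<^bsub>L\<^esub> \<eta> A"
        using G_ide[OF FA] by simp
    qed
  qed
  show ?thesis
    using F G nat_eta nat_eps triangle eps_eta by (simp add: adjunction_def)
qed

section \<open>Full subcategories and the restriction of an adjunction to its fixpoints\<close>

lemma hom_full_subcat: "hom (full_subcat K P) A B = (if P A \<and> P B then hom K A B else {})"
  by (auto simp: hom_def full_subcat_def)

lemma full_subcat_simps [simp]:
  "src (full_subcat K P) = src K" "tgt (full_subcat K P) = tgt K"
  "ide (full_subcat K P) = ide K" "cmp (full_subcat K P) = cmp K"
  "A \<in> Ob (full_subcat K P) \<longleftrightarrow> A \<in> Ob K \<and> P A"
  "f \<in> Ar (full_subcat K P) \<longleftrightarrow> f \<in> Ar K \<and> P (src K f) \<and> P (tgt K f)"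
  by (auto simp: full_subcat_def)

lemma category_full_subcat:
  assumes "category K"
  shows "category (full_subcat K P)"
proof -
  interpret category K by fact
  show ?thesis
    by unfold_locales
      (auto simp: hom_full_subcat src_Ob tgt_Ob ide_hom hom_iff cmp_cmp split: if_splits)
qed

lemma is_functor_full_subcat:
  assumes F: "is_functor K L F" and PQ: "\<And>A. \<lbrakk>A \<in> Ob K; P A\<rbrakk> \<Longrightarrow> Q (on_ob F A)"
  shows "is_functor (full_subcat K P) (full_subcat L Q) F"
proof -
  interpret K: category K using F by (simp add: is_functor_def)
  show ?thesis
    using F PQ K.src_Ob K.tgt_Ob
    by (auto simp: is_functor_def category_full_subcat hom_full_subcat)
qed

text \<open>Fullness lets naturality and the triangle identities carry over verbatim; what has to be
  supplied is that each functor lands in the chosen objects.\<close>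

lemma adjunction_full_subcat:
  assumes adj: "adjunction K L F G \<eta> \<epsilon>"
    and F: "\<And>A. \<lbrakk>A \<in> Ob L; Q A\<rbrakk> \<Longrightarrow> P (on_ob F A)"
    and G: "\<And>p. \<lbrakk>p \<in> Ob K; P p\<rbrakk> \<Longrightarrow> Q (on_ob G p)"
  shows "adjunction (full_subcat K P) (full_subcat L Q) F G \<eta> \<epsilon>"
proof -
  have fs: "is_functor L K F" "is_functor K L G" "is_functor L L ftor_id" "is_functor K K ftor_id"
    "is_functor L L (ftor_comp G F)" "is_functor K K (ftor_comp F G)"
    using adj by (auto simp: adjunction_def is_nat_trans_def)
  then have obs: "A \<in> Ob L \<Longrightarrow> on_ob F A \<in> Ob K" "p \<in> Ob K \<Longrightarrow> on_ob G p \<in> Ob L" for A p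
    by (auto simp: is_functor_def)
  have "is_functor (full_subcat L Q) (full_subcat K P) F"
    "is_functor (full_subcat K P) (full_subcat L Q) G"
    "is_functor (full_subcat L Q) (full_subcat L Q) ftor_id"
    "is_functor (full_subcat K P) (full_subcat K P) ftor_id"
    "is_functor (full_subcat L Q) (full_subcat L Q) (ftor_comp G F)"
    "is_functor (full_subcat K P) (full_subcat K P) (ftor_comp F G)"
    using fs obs F G by (auto intro!: is_functor_full_subcat simp: ftor_id_def ftor_comp_def)
  with adj show ?thesis
    using F G obs
    by (auto simp: adjunction_def is_nat_trans_def hom_full_subcat ftor_id_def ftor_comp_def)
qed

lemma is_iso_full_subcat:
  assumes "is_iso K f" "P (src K f)" "P (tgt K f)"
  shows "is_iso (full_subcat K P) f"
  using assms by (auto simp: is_iso_def hom_full_subcat)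

text \<open>The point is that the functors exchange the two kinds of fixpoints. If the unit at
  \<open>A\<close> is invertible, so is its image under \<open>F\<close>, and the triangle identity
  makes the counit at \<open>on_ob F A\<close> a one-sided inverse of that image; dually for
  \<open>G\<close>.\<close>

lemma adjoint_equivalence_fixpoints:
  assumes adj: "adjunction K L F G \<eta> \<epsilon>"
    and left: "left_fixpoints K \<epsilon> = Ob (full_subcat K P)"
    and right: "right_fixpoints L \<eta> = Ob (full_subcat L Q)"
  shows "adjoint_equivalence (full_subcat K P) (full_subcat L Q) F G \<eta> \<epsilon>"
proof -
  have F: "is_functor L K F" and G: "is_functor K L G"
    using adj by (auto simp: adjunction_def)
  interpret K: category K using G by (simp add: is_functor_def)
  interpret L: category L using G by (simp add: is_functor_def)
  have F_ob: "A \<in> Ob L \<Longrightarrow> on_ob F A \<in> Ob K"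
    and G_ob: "p \<in> Ob K \<Longrightarrow> on_ob G p \<in> Ob L" for A p
    using F G by (auto simp: is_functor_def)
  have eta: "\<eta> A \<in> hom L A (on_ob G (on_ob F A))" if "A \<in> Ob L" for A
    using adj that by (auto simp: adjunction_def is_nat_trans_def ftor_id_def ftor_comp_def)
  have eps: "\<epsilon> p \<in> hom K (on_ob F (on_ob G p)) p" if "p \<in> Ob K" for p
    using adj that by (auto simp: adjunction_def is_nat_trans_def ftor_id_def ftor_comp_def)
  have P: "p \<in> Ob K \<Longrightarrow> P p \<longleftrightarrow> is_iso K (\<epsilon> p)" for p
    using left by (auto simp: left_fixpoints_def set_eq_iff)
  have Q: "A \<in> Ob L \<Longrightarrow> Q A \<longleftrightarrow> is_iso L (\<eta> A)" for A
    using right by (auto simp: right_fixpoints_def set_eq_iff)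
  have FP: "P (on_ob F A)" if A: "A \<in> Ob L" "Q A" for A
  proof -
    have "is_iso K (on_ar F (\<eta> A))"
      using Q[OF A(1)] A(2) by (intro is_functor_iso[OF F]) simp
    moreover have "on_ar F (\<eta> A) \<in> hom K (on_ob F A) (on_ob F (on_ob G (on_ob F A)))"
      using F eta[OF A(1)] by (auto simp: is_functor_def L.hom_iff)
    moreover have "\<epsilon> (on_ob F A) \<cdot>\<^bsub>K\<^esub> on_ar F (\<eta> A) = ide K (on_ob F A)"
      using adj A by (simp add: adjunction_def)
    ultimately have "is_iso K (\<epsilon> (on_ob F A))"
      by (rule K.retraction_of_iso_is_iso[OF _ _ eps[OF F_ob[OF A(1)]]])
    then show ?thesis using P[OF F_ob[OF A(1)]] by simp
  qed
  have GQ: "Q (on_ob G p)" if p: "p \<in> Ob K" "P p" for p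
  proof -
    have "is_iso L (on_ar G (\<epsilon> p))"
      using P[OF p(1)] p(2) by (intro is_functor_iso[OF G]) simp
    moreover have "on_ar G (\<epsilon> p) \<in> hom L (on_ob G (on_ob F (on_ob G p))) (on_ob G p)"
      using G eps[OF p(1)] by (auto simp: is_functor_def K.hom_iff)
    moreover have "on_ar G (\<epsilon> p) \<cdot>\<^bsub>L\<^esub> \<eta> (on_ob G p) = ide L (on_ob G p)"
      using adj p by (simp add: adjunction_def)
    ultimately have "is_iso L (\<eta> (on_ob G p))"
      by (rule L.section_of_iso_is_iso[OF _ _ eta[OF G_ob[OF p(1)]]])
    then show ?thesis using Q[OF G_ob[OF p(1)]] by simp
  qed
  have "is_iso (full_subcat L Q) (\<eta> A)" if "A \<in> Ob L" "Q A" for A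
    using that Q FP GQ F_ob eta[OF that(1)] by (intro is_iso_full_subcat) (auto simp: L.hom_iff)
  moreover have "is_iso (full_subcat K P) (\<epsilon> p)" if "p \<in> Ob K" "P p" for p
    using that P FP GQ G_ob eps[OF that(1)] by (intro is_iso_full_subcat) (auto simp: K.hom_iff)
  ultimately show ?thesis
    using adjunction_full_subcat[where P = P and Q = Q, OF adj FP GQ] by (simp add: adjoint_equivalence_def)
qed

section \<open>Joins in a join restriction category\<close>

context restriction_category
begin

lemma rst_Ar [simp]: "f \<in> Ar C \<Longrightarrow> rst C f \<in> Ar C"
  and src_rst [simp]: "f \<in> Ar C \<Longrightarrow> src C (rst C f) = src C f"
  and tgt_rst [simp]: "f \<in> Ar C \<Longrightarrow> tgt C (rst C f) = src C f"
  using rst_hom[of f "src C f" "tgt C f"] by (auto simp: hom_iff)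

lemma cmp_rst_self [simp]: "f \<in> Ar C \<Longrightarrow> f \<cdot> rst C f = f"
  using cmp_rst[of f "src C f" "tgt C f"] by (auto simp: hom_iff)

lemma rst_commute: "\<lbrakk>f \<in> Ar C; g \<in> Ar C; src C f = src C g\<rbrakk> \<Longrightarrow> rst C f \<cdot> rst C g = rst C g \<cdot> rst C f"
  using rst_comm[of f "src C f" "tgt C f" g "tgt C g"] by (auto simp: hom_iff)

lemma rst_cmp_rst_eq:
  "\<lbrakk>f \<in> Ar C; g \<in> Ar C; src C f = src C g\<rbrakk> \<Longrightarrow> rst C (g \<cdot> rst C f) = rst C g \<cdot> rst C f"
  using rst_cmp_rst[of f "src C f" "tgt C f" g "tgt C g"] by (auto simp: hom_iff)

lemma rst_cmp_eq:
  "\<lbrakk>f \<in> Ar C; g \<in> Ar C; src C g = tgt C f\<rbrakk> \<Longrightarrow> rst C g \<cdot> f = f \<cdot> rst C (g \<cdot> f)"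
  using rst_cmp[of f "src C f" "tgt C f" g "tgt C g"] by (auto simp: hom_iff)

lemma rst_ide [simp]: "A \<in> Ob C \<Longrightarrow> rst C (ide C A) = ide C A"
  using cmp_rst_self[of "ide C A"] ide_cmp[of "rst C (ide C A)" A] by simp

lemma rst_rst [simp]: "f \<in> Ar C \<Longrightarrow> rst C (rst C f) = rst C f"
  using rst_cmp_rst_eq[of f "ide C (src C f)"] src_Ob[of f] by simp

lemma rst_idem [simp]: "f \<in> Ar C \<Longrightarrow> rst C f \<cdot> rst C f = rst C f"
  using rst_cmp_rst_eq[of f f] by simp

lemma rst_cmp_below:
  assumes "f \<in> Ar C" "g \<in> Ar C" "src C g = tgt C f"
  shows "rst C (g \<cdot> f) \<cdot> rst C f = rst C (g \<cdot> f)"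
  using rst_cmp_rst_eq[of f "g \<cdot> f"] assms by (simp add: cmp_cmp)

text \<open>The last restriction axiom turns \<open>rst C g \<cdot> f\<close> into
  \<open>f \<cdot> rst C (g \<cdot> f)\<close>, whose restriction is
  \<open>rst C f \<cdot> rst C (g \<cdot> f)\<close>; here the second factor is already below the
  first.\<close>

lemma rst_rst_cmp:
  assumes "f \<in> Ar C" "g \<in> Ar C" "src C g = tgt C f"
  shows "rst C (rst C g \<cdot> f) = rst C (g \<cdot> f)"
  using rst_cmp_below[OF assms] rst_commute[of "g \<cdot> f" f] rst_cmp_rst_eq[of "g \<cdot> f" f] assms
  by (simp add: rst_cmp_eq[OF assms])

lemma rids_iff: "e \<in> rids C A \<longleftrightarrow> e \<in> Ar C \<and> src C e = A \<and> tgt C e = A \<and> rst C e = e"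
  by (auto simp: rids_def hom_iff)

lemma rst_rids: "\<lbrakk>f \<in> Ar C; src C f = A\<rbrakk> \<Longrightarrow> rst C f \<in> rids C A"
  by (simp add: rids_iff)

lemma rids_commute: "\<lbrakk>d \<in> rids C A; e \<in> rids C A\<rbrakk> \<Longrightarrow> d \<cdot> e = e \<cdot> d"
  using rst_commute[of d e] by (auto simp: rids_iff)

lemma rids_idem: "e \<in> rids C A \<Longrightarrow> e \<cdot> e = e"
  using rst_idem[of e] by (auto simp: rids_iff)

lemma rids_idem_cmp: "\<lbrakk>e \<in> rids C A; f \<in> Ar C; tgt C f = A\<rbrakk> \<Longrightarrow> e \<cdot> (e \<cdot> f) = e \<cdot> f"
  using rids_idem[of e A] cmp_cmp[of f e e] by (auto simp: rids_iff)

lemma rst_cmp_rids: "\<lbrakk>f \<in> Ar C; e \<in> rids C (src C f)\<rbrakk> \<Longrightarrow> rst C (f \<cdot> e) = rst C f \<cdot> e"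
  using rst_cmp_rst_eq[of e f] by (auto simp: rids_iff)

lemma rids_cmp: "\<lbrakk>d \<in> rids C A; e \<in> rids C A\<rbrakk> \<Longrightarrow> d \<cdot> e \<in> rids C A"
  using rst_cmp_rids[of d e] by (auto simp: rids_iff)

lemma rle_cmp_rids:
  assumes f: "f \<in> Ar C" and e: "e \<in> rids C (src C f)"
  shows "rle C (f \<cdot> e) f"
proof -
  have "f \<cdot> (rst C f \<cdot> e) = (f \<cdot> rst C f) \<cdot> e"
    using e f by (intro cmp_cmp[symmetric]) (simp_all add: rids_iff)
  also have "\<dots> = f \<cdot> e" using f by simp
  finally show ?thesis by (simp add: rle_def rst_cmp_rids[OF f e])
qed

lemma rle_rst_iff:
  "\<lbrakk>d \<in> rids C A; e \<in> rids C A\<rbrakk> \<Longrightarrow> rle C d e \<longleftrightarrow> d = e \<cdot> d"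
  by (simp add: rle_def rids_iff)

lemma rle_refl: "f \<in> Ar C \<Longrightarrow> rle C f f"
  by (simp add: rle_def)

lemma rle_rst:
  assumes "f \<in> hom C A B" "g \<in> hom C A B" "rle C f g"
  shows "rst C f = rst C g \<cdot> rst C f"
  using assms rst_cmp_rst_eq[of f g] by (simp add: rle_def hom_iff)

lemma rle_rst_mono:
  assumes "f \<in> hom C A B" "g \<in> hom C A B" "rle C f g"
  shows "rle C (rst C f) (rst C g)"
  using rle_rst[OF assms] assms by (simp add: rle_def hom_iff)

lemma rle_antisym:
  assumes "f \<in> hom C A B" "g \<in> hom C A B" "rle C f g" "rle C g f"
  shows "f = g"
proof -
  have "rst C f = rst C g"
    using rle_rst[OF assms(1,2,3)] rle_rst[OF assms(2,1,4)] rst_commute[of f g] assms(1,2)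
    by (simp add: hom_iff)
  then show ?thesis using assms by (simp add: rle_def hom_iff)
qed

lemma rle_postcomp:
  assumes f: "f \<in> hom C A B" and g: "g \<in> hom C A B" and h: "h \<in> hom C B D" and "rle C f g"
  shows "rle C (h \<cdot> f) (h \<cdot> g)"
proof -
  have "h \<cdot> f = (h \<cdot> g) \<cdot> rst C f"
    using assms by (simp add: rle_def hom_iff cmp_cmp)
  then show ?thesis
    using rle_cmp_rids[of "h \<cdot> g" "rst C f"] f g h by (simp add: hom_iff rst_rids)
qed

text \<open>Both composites are the restriction of the common bound \<open>h\<close> to the meet
  \<open>rst C f \<cdot> rst C g\<close>.\<close>

lemma rle_imp_compat:
  assumes "f \<in> hom C A B" "g \<in> hom C A B" "h \<in> hom C A B" "rle C f h" "rle C g h"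
  shows "compat C f g"
proof -
  have "f \<cdot> rst C g = h \<cdot> (rst C f \<cdot> rst C g)"
    using assms cmp_cmp[of "rst C g" "rst C f" h] by (simp add: rle_def hom_iff)
  moreover have "g \<cdot> rst C f = h \<cdot> (rst C g \<cdot> rst C f)"
    using assms cmp_cmp[of "rst C f" "rst C g" h] by (simp add: rle_def hom_iff)
  ultimately show ?thesis
    using assms rst_commute[of f g] by (simp add: compat_def hom_iff)
qed

lemma is_join_unique: "\<lbrakk>is_join C A B F j; is_join C A B F k\<rbrakk> \<Longrightarrow> j = k"
  using rle_antisym[of j A B k] by (simp add: is_join_def is_lub_in_def)

lemma join_eq: "is_join C A B F j \<Longrightarrow> join C A B F = j"
  unfolding join_def using is_join_unique by blast

lemma is_join_hom: "is_join C A B F j \<Longrightarrow> j \<in> hom C A B"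
  and is_join_mem_hom: "\<lbrakk>is_join C A B F j; f \<in> F\<rbrakk> \<Longrightarrow> f \<in> hom C A B"
  and is_join_upper: "\<lbrakk>is_join C A B F j; f \<in> F\<rbrakk> \<Longrightarrow> rle C f j"
  and is_join_least: "\<lbrakk>is_join C A B F j; k \<in> hom C A B; \<And>f. f \<in> F \<Longrightarrow> rle C f k\<rbrakk> \<Longrightarrow> rle C j k"
  by (auto simp: is_join_def is_lub_in_def)

text \<open>The join is a common upper bound. This discharges the compatibility hypothesis of
  \<open>join_precomp\<close> once and for all.\<close>

lemma is_join_compat:
  assumes "is_join C A B F j"
  shows "\<forall>f \<in> F. \<forall>g \<in> F. compat C f g"
  using is_join_mem_hom[OF assms] is_join_upper[OF assms]
  by (blast intro: rle_imp_compat[OF _ _ is_join_hom[OF assms]])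

end

section \<open>Joins of idempotents, of restrictions and of composites\<close>

context join_restriction_category
begin

lemma is_join_precomp:
  "\<lbrakk>is_join C A B F j; h \<in> hom C A' A\<rbrakk> \<Longrightarrow> is_join C A' B ((\<lambda>f. f \<cdot> h) ` F) (j \<cdot> h)"
  using join_precomp is_join_compat by blast

text \<open>Idempotents commute, so any family of them is compatible; its join lies below the
  identity, and a map below the identity equals its own restriction.\<close>

lemma rids_join_ex:
  assumes "A \<in> Ob C" "F \<subseteq> rids C A"
  shows "\<exists>j \<in> rids C A. is_join C A A F j"
proof -
  have "\<forall>f \<in> F. \<forall>g \<in> F. compat C f g"
    using assms rids_commute by (auto simp: compat_def rids_iff subset_iff)
  then obtain j where j: "is_join C A A F j"
    using join_ex[of A A F] assms by (auto simp: rids_def)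
  have "rle C j (ide C A)"
    using j assms by (intro is_join_least[OF j]) (auto simp: ide_hom rle_def rids_iff subset_iff)
  then have "j \<in> rids C A"
    using is_join_hom[OF j] assms(1) unfolding rle_def hom_iff
    by (metis ide_cmp rids_iff rst_Ar rst_rst src_rst tgt_rst)
  then show ?thesis using j by auto
qed

text \<open>Let \<open>e\<close> be the join of the restrictions. It is below \<open>rst C j\<close>
  since each restriction is. Conversely \<open>j \<cdot> e\<close> still dominates the family, so
  \<open>j\<close> is below \<open>j \<cdot> e\<close>, which forces \<open>rst C j\<close> below
  \<open>e\<close>.\<close>

lemma is_join_rst:
  assumes j: "is_join C A B F j"
  shows "is_join C A A (rst C ` F) (rst C j)"
proof -
  note jh = is_join_hom[OF j]
  have A: "A \<in> Ob C" using hom_Ob[OF jh] by simp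
  have F: "f \<in> Ar C \<and> src C f = A \<and> tgt C f = B" if "f \<in> F" for f
    using is_join_mem_hom[OF j that] by (simp add: hom_iff)
  have "rst C ` F \<subseteq> rids C A" using F by (auto intro: rst_rids)
  then obtain e where e: "e \<in> rids C A" "is_join C A A (rst C ` F) e"
    using rids_join_ex[OF A] by blast
  have rj: "rst C j \<in> rids C A" using jh by (simp add: hom_iff rst_rids)
  have "rle C e (rst C j)"
    using rj F rle_rst_mono[OF is_join_mem_hom[OF j] jh is_join_upper[OF j]]
    by (intro is_join_least[OF e(2)]) (auto simp: rids_def)
  then have e_eq: "e = rst C j \<cdot> e"
    using rle_rst_iff[OF e(1) rj] by simp
  have je: "j \<cdot> e \<in> hom C A B" using jh e(1) by (simp add: hom_iff rids_iff)
  have "rle C j (j \<cdot> e)"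
  proof (rule is_join_least[OF j je])
    fix f assume f: "f \<in> F"
    have "rst C f \<in> rids C A" using F[OF f] by (simp add: rst_rids)
    then have "rst C f = e \<cdot> rst C f"
      using rle_rst_iff[OF _ e(1)] is_join_upper[OF e(2)] f by blast
    then show "rle C f (j \<cdot> e)"
      using is_join_upper[OF j f] F[OF f] e(1) jh
      by (simp add: rle_def rids_iff hom_iff cmp_cmp)
  qed
  then have "rst C j = rst C (j \<cdot> e) \<cdot> rst C j"
    using rle_rst[OF jh je] by simp
  also have "rst C (j \<cdot> e) = e"
    using rst_cmp_rids[of j e] e_eq e(1) jh by (simp add: hom_iff)
  also have "e \<cdot> rst C j = e"
    using rids_commute[OF e(1) rj] e_eq by simp
  finally show ?thesis using e(2) by simp
qed

text \<open>Only precomposition is assumed to preserve joins; for a composite \<open>h \<cdot> j\<close> the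
  restriction idempotent of \<open>h \<cdot> j\<close> is precomposed with the join \<open>rst C j\<close>.\<close>

lemma is_join_postcomp:
  assumes j: "is_join C A B F j" and h: "h \<in> hom C B D"
  shows "is_join C A D ((\<lambda>f. h \<cdot> f) ` F) (h \<cdot> j)"
proof -
  note jh = is_join_hom[OF j]
  have AD: "A \<in> Ob C" "D \<in> Ob C" using hom_Ob[OF jh] hom_Ob[OF h] by auto
  have hj: "h \<cdot> j \<in> hom C A D" using cmp_hom[OF jh h] .
  have hF: "(\<lambda>f. h \<cdot> f) ` F \<subseteq> hom C A D"
    using cmp_hom[OF is_join_mem_hom[OF j] h] by auto
  have up: "rle C f (h \<cdot> j)" if "f \<in> (\<lambda>f. h \<cdot> f) ` F" for f
    using that rle_postcomp[OF is_join_mem_hom[OF j] jh h is_join_upper[OF j]] by auto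
  have "\<forall>f \<in> (\<lambda>f. h \<cdot> f) ` F. \<forall>g \<in> (\<lambda>f. h \<cdot> f) ` F. compat C f g"
    using hF up by (blast intro: rle_imp_compat[OF _ _ hj])
  then obtain k where k: "is_join C A D ((\<lambda>f. h \<cdot> f) ` F) k"
    using join_ex[OF AD hF] by blast
  note kh = is_join_hom[OF k]
  have k_le: "rle C k (h \<cdot> j)" using is_join_least[OF k hj up] .
  define d where "d = rst C (h \<cdot> j)"
  have d: "d \<in> rids C A" using hj by (simp add: d_def hom_iff rst_rids)
  then have dh: "d \<in> hom C A A" by (simp add: rids_def)
  have rk: "rst C k \<in> rids C A" using kh by (simp add: hom_iff rst_rids)
  have "rle C (rst C j \<cdot> d) (rst C k)"
  proof (rule is_join_least[OF is_join_precomp[OF is_join_rst[OF j] dh]])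
    show "rst C k \<in> hom C A A" using rk by (simp add: rids_def)
  next
    fix x assume "x \<in> (\<lambda>f. f \<cdot> d) ` rst C ` F"
    then obtain f where f: "f \<in> F" and x: "x = rst C f \<cdot> d" by auto
    have fh: "f \<in> hom C A B" using is_join_mem_hom[OF j f] .
    have "x = rst C ((h \<cdot> j) \<cdot> rst C f)"
      using x fh hj rst_cmp_rst_eq[of f "h \<cdot> j"] rst_commute[of f "h \<cdot> j"]
      by (simp add: d_def hom_iff)
    also have "(h \<cdot> j) \<cdot> rst C f = h \<cdot> f"
      using is_join_upper[OF j f] fh jh h by (simp add: rle_def hom_iff cmp_cmp)
    finally show "rle C x (rst C k)"
      using rle_rst_mono[OF cmp_hom[OF fh h] kh] is_join_upper[OF k] f by simp
  qed
  moreover have "rst C j \<cdot> d = d"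
    using rst_cmp_below[of j h] rst_commute[of j "h \<cdot> j"] jh h by (simp add: d_def hom_iff)
  ultimately have "d = rst C k \<cdot> d" using rle_rst_iff[OF d rk] by simp
  then have d_eq: "d = d \<cdot> rst C k" using rids_commute[OF d rk] by simp
  \<comment> \<open>Since \<open>d\<close> is below \<open>rst C k\<close>, restricting
    \<open>h \<cdot> j\<close> to \<open>rst C k\<close> leaves it unchanged, while \<open>k\<close>
    being below \<open>h \<cdot> j\<close> says that this restriction is \<open>k\<close>.\<close>
  have "h \<cdot> j = (h \<cdot> j) \<cdot> d" using hj by (simp add: d_def hom_iff)
  also have "\<dots> = ((h \<cdot> j) \<cdot> d) \<cdot> rst C k"
    using d_eq d rk hj by (metis cmp_cmp hom_iff rids_iff)
  also have "(h \<cdot> j) \<cdot> d = h \<cdot> j" using hj by (simp add: d_def hom_iff)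
  also have "(h \<cdot> j) \<cdot> rst C k = k" using k_le by (simp add: rle_def)
  finally show ?thesis using k by simp
qed

text \<open>Equality is local: postcomposition with \<open>f\<close> and with \<open>g\<close> sends
  the cover \<open>E\<close> to the same family, and the join of that family is unique.\<close>

lemma eq_on_join:
  assumes E: "is_join C A B E j" and f: "f \<in> hom C B D" and g: "g \<in> hom C B D"
    and eq: "\<And>e. e \<in> E \<Longrightarrow> f \<cdot> e = g \<cdot> e"
  shows "f \<cdot> j = g \<cdot> j"
proof -
  have "(\<lambda>e. f \<cdot> e) ` E = (\<lambda>e. g \<cdot> e) ` E" using eq by auto
  then show ?thesis
    using is_join_unique[OF is_join_postcomp[OF E f]] is_join_postcomp[OF E g] by simp
qed

end

section \<open>Maps out of a local homeomorphism\<close>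

context restriction_category
begin

lemma partial_sections_iff:
  "t \<in> partial_sections C p \<longleftrightarrow>
     t \<in> Ar C \<and> src C t = tgt C p \<and> tgt C t = src C p \<and> p \<cdot> t = rst C t"
  by (auto simp: partial_sections_def hom_iff)

lemma partial_sections_cmp_rids:
  assumes "p \<in> Ar C" "t \<in> partial_sections C p" "e \<in> rids C (tgt C p)"
  shows "t \<cdot> e \<in> partial_sections C p"
proof -
  have "p \<cdot> (t \<cdot> e) = (p \<cdot> t) \<cdot> e"
    using assms by (intro cmp_cmp[symmetric]) (simp_all add: partial_sections_iff rids_iff)
  also have "\<dots> = rst C (t \<cdot> e)"
    using assms rst_cmp_rids[of t e] by (simp add: partial_sections_iff)
  finally show ?thesis using assms by (simp add: partial_sections_iff rids_iff)
qed

lemma total_cmp: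
  assumes "total C f" "total C g" "src C g = tgt C f"
  shows "total C (g \<cdot> f)"
  using assms rst_rst_cmp[of f g] by (simp add: total_def)

end

text \<open>\<open>D\<close> is always \<open>src C p\<close>, but the simplification rule \<open>src C p = D\<close> below would loop
  if \<open>D\<close> were instantiated by \<open>src C p\<close>, so interpretations name the source first.\<close>

locale charted = join_restriction_category C
  for C :: "('o, 'm, 'z) rcat_scheme" (structure) +
  fixes D X :: 'o and p :: 'm and I :: "'i set" and c s :: "'i \<Rightarrow> 'm"
  assumes p_hom: "p \<in> hom C D X"
    and p_total: "rst C p = ide C D"
    and p_join: "is_join C D X (c ` I) p"
    and c_inverse: "i \<in> I \<Longrightarrow> partial_inverse C (c i) (s i)"
begin

lemma p_simps [simp]: "p \<in> Ar C" "src C p = D" "tgt C p = X" "D \<in> Ob C" "X \<in> Ob C"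
  using p_hom hom_Ob[OF p_hom] by (auto simp: hom_iff)

lemma c_simps [simp]:
  assumes "i \<in> I"
  shows "c i \<in> Ar C" "src C (c i) = D" "tgt C (c i) = X"
  using is_join_mem_hom[OF p_join] assms by (auto simp: hom_iff)

lemma s_simps [simp]:
  assumes "i \<in> I"
  shows "s i \<in> Ar C" "src C (s i) = X" "tgt C (s i) = D"
  using c_inverse[OF assms] assms by (auto simp: partial_inverse_def hom_iff)

lemma s_cmp_c: "i \<in> I \<Longrightarrow> s i \<cdot> c i = rst C (c i)"
  and c_cmp_s: "i \<in> I \<Longrightarrow> c i \<cdot> s i = rst C (s i)"
  using c_inverse by (auto simp: partial_inverse_def)

lemma p_cmp_rst_c: "i \<in> I \<Longrightarrow> p \<cdot> rst C (c i) = c i"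
  using is_join_upper[OF p_join, of "c i"] by (simp add: rle_def)

text \<open>As \<open>c i\<close> is \<open>p\<close> cut down to a domain,
  \<open>c i \<cdot> t\<close> is the idempotent \<open>p \<cdot> t\<close> cut down to the part of
  \<open>X\<close> that \<open>t\<close> maps into this domain. There \<open>s i \<cdot> c i\<close>
  acts as an identity, so \<open>t\<close> and \<open>s i\<close> agree.\<close>

lemma c_cmp_section:
  assumes i: "i \<in> I" and t: "t \<in> partial_sections C p"
  shows "c i \<cdot> t \<in> rids C X" "s i \<cdot> (c i \<cdot> t) = t \<cdot> (c i \<cdot> t)"
proof -
  have [simp]: "t \<in> Ar C" "src C t = X" "tgt C t = D" "i \<in> I"
    using t i by (simp_all add: partial_sections_iff)
  have "c i \<cdot> t = (p \<cdot> rst C (c i)) \<cdot> t"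
    by (simp only: p_cmp_rst_c[OF i])
  also have "\<dots> = p \<cdot> (rst C (c i) \<cdot> t)"
    by (rule cmp_cmp) simp_all
  also have "rst C (c i) \<cdot> t = t \<cdot> rst C (c i \<cdot> t)"
    by (rule rst_cmp_eq) simp_all
  also have "p \<cdot> (t \<cdot> rst C (c i \<cdot> t)) = (p \<cdot> t) \<cdot> rst C (c i \<cdot> t)"
    by (rule cmp_cmp[symmetric]) simp_all
  also have "\<dots> = rst C (c i \<cdot> t)"
    using t rst_cmp_below[of t "c i"] rst_commute[of t "c i \<cdot> t"]
    by (simp add: partial_sections_iff)
  finally have eq: "c i \<cdot> t = rst C (c i \<cdot> t)" .
  then show "c i \<cdot> t \<in> rids C X" by (simp add: rids_iff)
  have "s i \<cdot> (c i \<cdot> t) = rst C (c i) \<cdot> t"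
    using s_cmp_c[OF i] cmp_cmp[of t "c i" "s i"] by simp
  also have "\<dots> = t \<cdot> rst C (c i \<cdot> t)"
    by (rule rst_cmp_eq) auto
  also have "\<dots> = t \<cdot> (c i \<cdot> t)" using eq by simp
  finally show "s i \<cdot> (c i \<cdot> t) = t \<cdot> (c i \<cdot> t)" .
qed

text \<open>The image of \<open>s i\<close> lies in the domain of \<open>c i\<close>, where
  \<open>p\<close> and \<open>c i\<close> coincide.\<close>

lemma s_section:
  assumes i: "i \<in> I"
  shows "s i \<in> partial_sections C p"
proof -
  note [simp] = i
  have "rst C (c i) \<cdot> s i = s i"
    using s_cmp_c[OF i] c_cmp_s[OF i] cmp_cmp[of "s i" "c i" "s i"] by simp
  then have "p \<cdot> s i = c i \<cdot> s i"
    using p_cmp_rst_c[OF i] cmp_cmp[of "s i" "rst C (c i)" p] by simp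
  then show ?thesis using c_cmp_s[OF i] by (simp add: partial_sections_iff)
qed

text \<open>Pulling the chart decomposition of \<open>p\<close> back along \<open>t\<close> covers
  the domain of \<open>t\<close>, because \<open>p \<cdot> t\<close> is
  \<open>rst C t\<close>.\<close>

lemma section_join:
  assumes "t \<in> partial_sections C p"
  shows "is_join C X X ((\<lambda>i. c i \<cdot> t) ` I) (rst C t)"
  using is_join_precomp[OF p_join, of t X] assms
  by (simp add: partial_sections_iff hom_iff image_image)

text \<open>The domains \<open>rst C (c i) = s i \<cdot> c i\<close> cover \<open>D\<close> because
  \<open>p\<close> is total, and on each of them a map is decided by its composite with
  \<open>s i\<close>.\<close>

lemma eqI:
  assumes f: "f \<in> hom C D B" and g: "g \<in> hom C D B"
    and eq: "\<And>i. i \<in> I \<Longrightarrow> f \<cdot> s i = g \<cdot> s i"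
  shows "f = g"
proof -
  have "f \<cdot> rst C p = g \<cdot> rst C p"
  proof (rule eq_on_join[OF is_join_rst[OF p_join] f g])
    fix e assume "e \<in> rst C ` c ` I"
    then obtain i where i: "i \<in> I" and e: "e = s i \<cdot> c i" using s_cmp_c by auto
    have "f \<cdot> e = (f \<cdot> s i) \<cdot> c i" "g \<cdot> e = (g \<cdot> s i) \<cdot> c i"
      using i f g by (simp_all add: e cmp_cmp hom_iff)
    then show "f \<cdot> e = g \<cdot> e" using eq[OF i] by simp
  qed
  then show ?thesis using f g p_total by (simp add: hom_iff)
qed

text \<open>On the domain of \<open>c i\<close> the equation \<open>h \<cdot> s i = \<phi> i\<close>
  leaves only \<open>\<phi> i \<cdot> c i\<close>, so \<open>h\<close> has to be the join of these
  pieces. Postcomposition with \<open>q\<close> turns the pieces into the charts \<open>c i\<close>,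
  which gives \<open>q \<cdot> h = p\<close>.\<close>

lemma lift_ex:
  assumes q: "q \<in> hom C B X"
    and \<phi>: "\<And>i. i \<in> I \<Longrightarrow> \<phi> i \<in> partial_sections C q"
    and rst_\<phi>: "\<And>i. i \<in> I \<Longrightarrow> rst C (\<phi> i) = rst C (s i)"
    and \<phi>_eq: "\<And>i j. \<lbrakk>i \<in> I; j \<in> I\<rbrakk> \<Longrightarrow> \<phi> i \<cdot> (c i \<cdot> s j) = \<phi> j \<cdot> (c i \<cdot> s j)"
  shows "\<exists>h \<in> hom C D B. q \<cdot> h = p \<and> (\<forall>i \<in> I. h \<cdot> s i = \<phi> i)"
proof -
  have q_simps [simp]: "q \<in> Ar C" "src C q = B" "tgt C q = X" "B \<in> Ob C"
    using q hom_Ob[OF q] by (auto simp: hom_iff)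
  have \<phi>_simps [simp]: "\<phi> i \<in> Ar C" "src C (\<phi> i) = X" "tgt C (\<phi> i) = B" if "i \<in> I" for i
    using \<phi>[OF that] by (auto simp: partial_sections_iff)
  have q_\<phi>: "q \<cdot> \<phi> i = rst C (s i)" if "i \<in> I" for i
    using \<phi>[OF that] rst_\<phi>[OF that] by (simp add: partial_sections_iff)
  have rst_s_c: "rst C (s i) \<cdot> c i = c i" if "i \<in> I" for i
    using that c_cmp_s[OF that] s_cmp_c[OF that] cmp_cmp[of "c i" "s i" "c i"] by simp
  define f where "f i = \<phi> i \<cdot> c i" for i
  have f_simps [simp]: "f i \<in> Ar C" "src C (f i) = D" "tgt C (f i) = B" if "i \<in> I" for i
    using that by (auto simp: f_def)
  have rst_f: "rst C (f i) = rst C (c i)" if i: "i \<in> I" for i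
    using rst_rst_cmp[of "c i" "\<phi> i"] rst_\<phi>[OF i] rst_s_c[OF i] i by (simp add: f_def)
  \<comment> \<open>On the overlap of two chart domains \<open>c i\<close> and \<open>c j\<close>
    coincide and factor through \<open>c i \<cdot> s j\<close>, where the hypothesis allows
    \<open>\<phi> i\<close> to be replaced by \<open>\<phi> j\<close>.\<close>
  have compat_f: "compat C (f i) (f j)" if ij: "i \<in> I" "j \<in> I" for i j
  proof -
    have c_ij: "c i \<cdot> rst C (c j) = (c i \<cdot> s j) \<cdot> c j"
      using ij s_cmp_c[of j] by (simp add: cmp_cmp)
    have "f i \<cdot> rst C (c j) = \<phi> i \<cdot> (c i \<cdot> rst C (c j))"
      using ij by (simp add: f_def cmp_cmp)
    also have "\<dots> = (\<phi> i \<cdot> (c i \<cdot> s j)) \<cdot> c j"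
      unfolding c_ij using ij by (intro cmp_cmp[symmetric]) auto
    also have "\<dots> = (\<phi> j \<cdot> (c i \<cdot> s j)) \<cdot> c j" using \<phi>_eq[OF ij] by simp
    also have "\<dots> = \<phi> j \<cdot> (c i \<cdot> rst C (c j))"
      unfolding c_ij using ij by (intro cmp_cmp) auto
    also have "c i \<cdot> rst C (c j) = c j \<cdot> rst C (c i)"
      using is_join_compat[OF p_join] ij by (simp add: compat_def)
    also have "\<phi> j \<cdot> (c j \<cdot> rst C (c i)) = f j \<cdot> rst C (c i)"
      using ij by (simp add: f_def cmp_cmp)
    finally show ?thesis using rst_f ij by (simp add: compat_def)
  qed
  have "f ` I \<subseteq> hom C D B" by (auto simp: hom_iff)
  then obtain h where h: "is_join C D B (f ` I) h"
    using join_ex[of D B "f ` I"] compat_f by auto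
  note h_hom = is_join_hom[OF h]
  have "q \<cdot> f i = c i" if i: "i \<in> I" for i
  proof -
    have "q \<cdot> f i = (q \<cdot> \<phi> i) \<cdot> c i" using i by (simp add: f_def cmp_cmp)
    then show ?thesis using q_\<phi>[OF i] rst_s_c[OF i] by simp
  qed
  then have "(\<lambda>x. q \<cdot> x) ` f ` I = c ` I" by (force simp: image_iff)
  then have "q \<cdot> h = p"
    using is_join_unique[OF is_join_postcomp[OF h q]] p_join by simp
  moreover have "h \<cdot> s i = \<phi> i" if i: "i \<in> I" for i
  proof -
    \<comment> \<open>\<open>s i\<close> lands in the domain of \<open>c i\<close>, where
      \<open>h\<close> is the piece \<open>f i\<close>.\<close>
    have "rst C (c i) \<cdot> s i = s i"
      using i s_cmp_c[OF i] c_cmp_s[OF i] cmp_cmp[of "s i" "c i" "s i"] by simp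
    then have "h \<cdot> s i = (h \<cdot> rst C (c i)) \<cdot> s i"
      using i h_hom by (simp add: cmp_cmp hom_iff)
    also have "h \<cdot> rst C (c i) = f i"
      using is_join_upper[OF h, of "f i"] i rst_f[OF i] by (simp add: rle_def)
    also have "f i \<cdot> s i = \<phi> i \<cdot> (c i \<cdot> s i)" using i by (simp add: f_def cmp_cmp)
    also have "\<dots> = \<phi> i" using i c_cmp_s[OF i] rst_\<phi>[OF i] cmp_rst_self[of "\<phi> i"] by simp
    finally show ?thesis .
  qed
  ultimately show ?thesis using h_hom by blast
qed

end

section \<open>Local homeomorphisms as charted maps\<close>

lemma (in join_restriction_category) local_homeo_charted:
  assumes "local_homeo C p"
  obtains F :: "'m set" and c s where "charted C (src C p) (tgt C p) p F c s"
proof -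
  obtain F where F: "\<forall>f \<in> F. partial_iso C f" "is_join C (src C p) (tgt C p) F p"
    and p: "total C p"
    using assms by (auto simp: local_homeo_def)
  obtain s where "\<forall>f \<in> F. partial_inverse C f (s f)"
    using F(1) unfolding partial_iso_def by metis
  \<comment> \<open>The partial isomorphisms of the decomposition index themselves, so the chart
    family is the identity.\<close>
  then have "charted C (src C p) (tgt C p) p F (\<lambda>f. f) s"
    using F p by unfold_locales (auto simp: total_def hom_iff)
  then show ?thesis by (rule that)
qed

text \<open>Precomposition preserves the join, and if \<open>f\<close> has partial inverse
  \<open>t\<close> then \<open>f \<cdot> g\<close> has partial inverse \<open>g' \<cdot> t\<close>;
  the maps \<open>g\<close> and \<open>g'\<close> are total because they are mutually
  inverse.\<close>

lemma (in join_restriction_category) local_homeo_cmp_iso: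
  assumes p: "local_homeo C p" "p \<in> hom C A X"
    and g: "g \<in> hom C B A" "g' \<in> hom C A B" "g' \<cdot> g = ide C B" "g \<cdot> g' = ide C A"
  shows "local_homeo C (p \<cdot> g)"
proof -
  have p_simps [simp]: "p \<in> Ar C" "src C p = A" "tgt C p = X"
    and g_simps [simp]: "g \<in> Ar C" "src C g = B" "tgt C g = A"
      "g' \<in> Ar C" "src C g' = A" "tgt C g' = B" and Ob [simp]: "A \<in> Ob C" "B \<in> Ob C"
    using p g(1,2) hom_Ob[OF g(1)] by (auto simp: hom_iff)
  have rst_g: "rst C g = ide C B"
    using rst_cmp_below[of g g'] g(3) by simp
  obtain F where F: "\<forall>f \<in> F. partial_iso C f" "is_join C A X F p" and tot: "total C p"
    using p(1) by (auto simp: local_homeo_def)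
  have "partial_iso C (f \<cdot> g)" if f: "f \<in> F" for f
  proof -
    have [simp]: "f \<in> Ar C" "src C f = A" "tgt C f = X"
      using is_join_mem_hom[OF F(2) f] by (auto simp: hom_iff)
    obtain t where t: "t \<in> hom C X A" "t \<cdot> f = rst C f" "f \<cdot> t = rst C t"
      using F(1) f by (auto simp: partial_iso_def partial_inverse_def)
    then have [simp]: "t \<in> Ar C" "src C t = X" "tgt C t = A" by (auto simp: hom_iff)
    have "(g' \<cdot> t) \<cdot> (f \<cdot> g) = g' \<cdot> ((t \<cdot> f) \<cdot> g)" by (simp add: cmp_cmp)
    also have "(t \<cdot> f) \<cdot> g = g \<cdot> rst C (f \<cdot> g)" using t(2) rst_cmp_eq[of g f] by simp
    also have "g' \<cdot> (g \<cdot> rst C (f \<cdot> g)) = (g' \<cdot> g) \<cdot> rst C (f \<cdot> g)" by (simp add: cmp_cmp)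
    also have "\<dots> = rst C (f \<cdot> g)" using g(3) by simp
    finally have 1: "(g' \<cdot> t) \<cdot> (f \<cdot> g) = rst C (f \<cdot> g)" .
    have gg: "g \<cdot> (g' \<cdot> t) = t" using g(4) cmp_cmp[of t g' g] by simp
    then have 2: "(f \<cdot> g) \<cdot> (g' \<cdot> t) = rst C t" using t(3) by (simp add: cmp_cmp)
    have "rst C g' = ide C A"
      using rst_cmp_below[of g' g] g(4) by simp
    then have "rst C (g' \<cdot> t) = rst C t"
      using rst_rst_cmp[of t g'] by simp
    with 1 2 show ?thesis
      unfolding partial_iso_def partial_inverse_def
      by (intro exI[of _ "g' \<cdot> t"]) (auto simp: hom_iff)
  qed
  moreover have "is_join C B X ((\<lambda>f. f \<cdot> g) ` F) (p \<cdot> g)"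
    using is_join_precomp[OF F(2) g(1)] .
  moreover have "total C (p \<cdot> g)"
    using total_cmp[of g p] tot rst_g by (simp add: total_def)
  ultimately show ?thesis
    unfolding local_homeo_def by (intro conjI exI[of _ "(\<lambda>f. f \<cdot> g) ` F"]) auto
qed

section \<open>Presheaves\<close>

lemma presheafD:
  assumes "presheaf small C X A"
  shows act_closed: "\<lbrakk>a \<in> carrier A; e \<in> rids C X\<rbrakk> \<Longrightarrow> act A a e \<in> carrier A"
    and act_act: "\<lbrakk>a \<in> carrier A; d \<in> rids C X; e \<in> rids C X\<rbrakk>
                    \<Longrightarrow> act A (act A a d) e = act A a (d \<cdot>\<^bsub>C\<^esub> e)"
    and extent_rids: "a \<in> carrier A \<Longrightarrow> extent A a \<in> rids C X"
    and act_extent: "a \<in> carrier A \<Longrightarrow> act A a (extent A a) = a"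
    and extent_act: "\<lbrakk>a \<in> carrier A; e \<in> rids C X\<rbrakk>
                       \<Longrightarrow> extent A (act A a e) = extent A a \<cdot>\<^bsub>C\<^esub> e"
  using assms by (auto simp: presheaf_def)

definition psh_map where
  "psh_map small C X A f B \<longleftrightarrow> presheaf small C X A \<and> presheaf small C X B \<and>
     f \<in> carrier A \<rightarrow>\<^sub>E carrier B \<and>
     (\<forall>a \<in> carrier A. \<forall>e \<in> rids C X. f (act A a e) = act B (f a) e) \<and>
     (\<forall>a \<in> carrier A. extent B (f a) = extent A a)"

lemma psh_mapD:
  assumes "psh_map small C X A f B"
  shows psh_map_dom: "presheaf small C X A" and psh_map_cod: "presheaf small C X B"
    and psh_map_extensional: "f \<in> carrier A \<rightarrow>\<^sub>E carrier B"
    and psh_map_closed: "a \<in> carrier A \<Longrightarrow> f a \<in> carrier B"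
    and psh_map_act: "\<lbrakk>a \<in> carrier A; e \<in> rids C X\<rbrakk> \<Longrightarrow> f (act A a e) = act B (f a) e"
    and psh_map_extent: "a \<in> carrier A \<Longrightarrow> extent B (f a) = extent A a"
  using assms by (auto simp: psh_map_def)

lemma Psh_simps [simp]:
  "A \<in> Ob (Psh small C X) \<longleftrightarrow> presheaf small C X A"
  "(A, f, B) \<in> Ar (Psh small C X) \<longleftrightarrow> psh_map small C X A f B"
  "src (Psh small C X) (A, f, B) = A"
  "tgt (Psh small C X) (A, f, B) = B"
  "ide (Psh small C X) A = (A, \<lambda>a \<in> carrier A. a, A)"
  "(B', g, D) \<cdot>\<^bsub>Psh small C X\<^esub> (A, f, B) = (A, compose (carrier A) g f, D)"
  by (auto simp: Psh_def psh_map_def)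

lemma hom_Psh: "m \<in> hom (Psh small C X) A B \<longleftrightarrow> (\<exists>f. m = (A, f, B) \<and> psh_map small C X A f B)"
  by (cases m) (auto simp: hom_def)

lemma psh_map_id: "presheaf small C X A \<Longrightarrow> psh_map small C X A (\<lambda>a \<in> carrier A. a) A"
  by (auto simp: psh_map_def act_closed)

lemma psh_map_compose:
  assumes "psh_map small C X A f B" "psh_map small C X B g D"
  shows "psh_map small C X A (compose (carrier A) g f) D"
  using psh_mapD[OF assms(1)] psh_mapD[OF assms(2)] act_closed[OF psh_map_dom[OF assms(1)]]
  by (auto simp: psh_map_def compose_def)

lemma category_Psh: "category (Psh small C X)"
proof
  fix f assume "f \<in> Ar (Psh small C X)"
  then show "src (Psh small C X) f \<in> Ob (Psh small C X)"
    and "tgt (Psh small C X) f \<in> Ob (Psh small C X)"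
    by (cases f; simp add: psh_map_def)+
next
  fix A assume "A \<in> Ob (Psh small C X)"
  then show "ide (Psh small C X) A \<in> hom (Psh small C X) A A"
    by (simp add: hom_Psh psh_map_id)
next
  fix f A B g D assume "f \<in> hom (Psh small C X) A B" "g \<in> hom (Psh small C X) B D"
  then show "g \<cdot>\<^bsub>Psh small C X\<^esub> f \<in> hom (Psh small C X) A D"
    by (auto simp: hom_Psh psh_map_compose)
next
  fix f A B assume f: "f \<in> hom (Psh small C X) A B"
  show "f \<cdot>\<^bsub>Psh small C X\<^esub> ide (Psh small C X) A = f"
    using f compose_Id[of _ "carrier A" "carrier B"]
    by (auto simp: hom_Psh PiE_def dest: psh_map_extensional)
  show "ide (Psh small C X) B \<cdot>\<^bsub>Psh small C X\<^esub> f = f"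
    using f by (auto simp: hom_Psh PiE_def Id_compose dest: psh_map_extensional)
next
  fix f A B g D h E assume "f \<in> hom (Psh small C X) A B" "g \<in> hom (Psh small C X) B D"
    "h \<in> hom (Psh small C X) D E"
  then show "h \<cdot>\<^bsub>Psh small C X\<^esub> (g \<cdot>\<^bsub>Psh small C X\<^esub> f)
      = (h \<cdot>\<^bsub>Psh small C X\<^esub> g) \<cdot>\<^bsub>Psh small C X\<^esub> f"
    by (auto simp: hom_Psh PiE_def compose_assoc dest: psh_map_extensional)
qed

section \<open>Sheaves and isomorphisms of presheaves\<close>

lemma psh_map_le:
  assumes "psh_map small C X A f B" "a \<in> carrier A" "b \<in> carrier A" "psh_le A a b"
  shows "psh_le B (f a) (f b)"
  using psh_mapD[OF assms(1)] extent_rids[OF psh_map_dom[OF assms(1)]] assms(2-)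
  unfolding psh_le_def by metis

lemma psh_map_compat:
  assumes "psh_map small C X A f B" "a \<in> carrier A" "b \<in> carrier A" "psh_compat A a b"
  shows "psh_compat B (f a) (f b)"
  using psh_mapD[OF assms(1)] extent_rids[OF psh_map_dom[OF assms(1)]] assms(2-)
  unfolding psh_compat_def by metis

lemma sheaf_join_ex:
  assumes "sheaf_cond A" and "\<And>i. i \<in> I \<Longrightarrow> f i \<in> carrier A"
    and "\<And>i j. \<lbrakk>i \<in> I; j \<in> I\<rbrakk> \<Longrightarrow> psh_compat A (f i) (f j)"
  shows "\<exists>j. is_lub_in (carrier A) (psh_le A) (f ` I) j"
proof -
  have "f ` I \<subseteq> carrier A" "\<forall>a \<in> f ` I. \<forall>b \<in> f ` I. psh_compat A a b"
    using assms(2,3) by auto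
  then show ?thesis using assms(1) unfolding sheaf_cond_def by meson
qed

text \<open>Presheaf maps preserve compatibility and order, so the join in \<open>B\<close> of the
  image family is carried back by \<open>g\<close>; its leastness is tested by moving upper bounds
  along \<open>f\<close>.\<close>

lemma sheaf_cond_iso:
  assumes f: "psh_map small C X A f B" and g: "psh_map small C X B g A"
    and gf: "\<And>a. a \<in> carrier A \<Longrightarrow> g (f a) = a" and fg: "\<And>b. b \<in> carrier B \<Longrightarrow> f (g b) = b"
    and B: "sheaf_cond B"
  shows "sheaf_cond A"
  unfolding sheaf_cond_def
proof (intro allI impI)
  fix F assume F: "F \<subseteq> carrier A" and comp: "\<forall>a \<in> F. \<forall>b \<in> F. psh_compat A a b"
  have "f ` F \<subseteq> carrier B" using F psh_map_closed[OF f] by auto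
  moreover have "\<forall>a \<in> f ` F. \<forall>b \<in> f ` F. psh_compat B a b"
    using F comp psh_map_compat[OF f] by blast
  ultimately obtain j where j: "is_lub_in (carrier B) (psh_le B) (f ` F) j"
    using B unfolding sheaf_cond_def by meson
  have jB: "j \<in> carrier B" using j by (simp add: is_lub_in_def)
  have "is_lub_in (carrier A) (psh_le A) F (g j)"
    unfolding is_lub_in_def
  proof (intro conjI ballI impI)
    show "g j \<in> carrier A" using psh_map_closed[OF g jB] .
    fix a assume a: "a \<in> F"
    then have "psh_le B (f a) j" using j by (simp add: is_lub_in_def)
    then have "psh_le A (g (f a)) (g j)"
      using a F jB psh_map_le[OF g] psh_map_closed[OF f] by blast
    then show "psh_le A a (g j)" using gf a F by auto
  next
    fix k assume k: "k \<in> carrier A" and ub: "\<forall>a \<in> F. psh_le A a k"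
    have "\<forall>b \<in> f ` F. psh_le B b (f k)"
      using k ub F psh_map_le[OF f] by blast
    then have "psh_le B j (f k)"
      using j k psh_map_closed[OF f] by (simp add: is_lub_in_def)
    then have "psh_le A (g j) (g (f k))"
      using psh_map_le[OF g jB psh_map_closed[OF f k]] by simp
    then show "psh_le A (g j) k" using gf k by simp
  qed
  then show "\<exists>j. is_lub_in (carrier A) (psh_le A) F j" by blast
qed

lemma compose_eq_id_iff: "compose S g f = (\<lambda>x \<in> S. x) \<longleftrightarrow> (\<forall>x \<in> S. g (f x) = x)"
  by (auto simp: compose_def fun_eq_iff)

lemma is_iso_Psh_iff:
  "is_iso (Psh small C X) (A, f, B) \<longleftrightarrow> psh_map small C X A f B \<and> (\<exists>g. psh_map small C X B g A \<and>
     (\<forall>a \<in> carrier A. g (f a) = a) \<and> (\<forall>b \<in> carrier B. f (g b) = b))"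
  by (auto simp: is_iso_def hom_Psh compose_eq_id_iff bex_simps Bex_def)

text \<open>Action and extent are preserved equationally, so the inverse function preserves them as
  well; it is restricted to \<open>carrier B\<close> to be extensional, as arrows of
  \<open>Psh\<close> must be.\<close>

lemma bij_psh_map_is_iso:
  assumes f: "psh_map small C X A f B" and bij: "bij_betw f (carrier A) (carrier B)"
  shows "is_iso (Psh small C X) (A, f, B)"
proof -
  define g where "g = restrict (inv_into (carrier A) f) (carrier B)"
  note fD = psh_mapD[OF f]
  have gA: "g b \<in> carrier A" and fg: "f (g b) = b" if "b \<in> carrier B" for b
    using bij_betw_inv_into_right[OF bij that] bij_betwE[OF bij_betw_inv_into[OF bij]] that
    by (auto simp: g_def)
  have gf: "g (f a) = a" if "a \<in> carrier A" for a
    using bij_betw_inv_into_left[OF bij that] fD(4)[OF that] by (simp add: g_def)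
  have "g (act B b e) = act A (g b) e" if "b \<in> carrier B" "e \<in> rids C X" for b e
    using gf[of "act A (g b) e"] fD(5)[of "g b" e] fg[of b] gA[of b] act_closed[OF fD(1)] that by simp
  moreover have "extent A (g b) = extent B b" if "b \<in> carrier B" for b
    using fD(6)[of "g b"] fg gA that by simp
  ultimately have "psh_map small C X B g A"
    using fD gA by (auto simp: psh_map_def) (auto simp: g_def)
  then show ?thesis using f fg gf by (auto simp: is_iso_Psh_iff)
qed

section \<open>The functor of partial sections\<close>

lemma total_slice_simps [simp]:
  "p \<in> Ob (total_slice C X) \<longleftrightarrow> total C p \<and> tgt C p = X"
  "(p, f, q) \<in> Ar (total_slice C X) \<longleftrightarrow> total C p \<and> tgt C p = X \<and> total C q \<and> tgt C q = X \<and>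
     f \<in> hom C (src C p) (src C q) \<and> q \<cdot>\<^bsub>C\<^esub> f = p"
  "src (total_slice C X) (p, f, q) = p"
  "tgt (total_slice C X) (p, f, q) = q"
  "ide (total_slice C X) p = (p, ide C (src C p), p)"
  "(q', g, r) \<cdot>\<^bsub>total_slice C X\<^esub> (p, f, q) = (p, g \<cdot>\<^bsub>C\<^esub> f, r)"
  by (auto simp: total_slice_def)

lemma hom_total_slice:
  "m \<in> hom (total_slice C X) p q \<longleftrightarrow> (\<exists>f. m = (p, f, q) \<and> total C p \<and> tgt C p = X \<and>
     total C q \<and> tgt C q = X \<and> f \<in> hom C (src C p) (src C q) \<and> q \<cdot>\<^bsub>C\<^esub> f = p)"
  by (cases m) (auto simp: hom_def)

lemma Gamma_ob_simps [simp]: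
  "carrier (Gamma_ob C p) = partial_sections C p"
  "act (Gamma_ob C p) t e = t \<cdot>\<^bsub>C\<^esub> e"
  "extent (Gamma_ob C p) = rst C"
  by (simp_all add: Gamma_ob_def)

lemma Gamma_simps [simp]:
  "on_ob (Gamma C) p = Gamma_ob C p"
  "on_ar (Gamma C) (p, f, q)
     = (Gamma_ob C p, \<lambda>t \<in> partial_sections C p. f \<cdot>\<^bsub>C\<^esub> t, Gamma_ob C q)"
  by (simp_all add: Gamma_def)

context restriction_category
begin

lemma category_total_slice: "category (total_slice C X)"
proof
  fix f assume "f \<in> Ar (total_slice C X)"
  then show "src (total_slice C X) f \<in> Ob (total_slice C X)"
    and "tgt (total_slice C X) f \<in> Ob (total_slice C X)"
    by (cases f; simp)+
next
  fix p assume "p \<in> Ob (total_slice C X)"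
  then show "ide (total_slice C X) p \<in> hom (total_slice C X) p p"
    by (simp add: hom_total_slice total_def ide_hom src_Ob)
next
  fix m n p q r assume m: "m \<in> hom (total_slice C X) p q" and n: "n \<in> hom (total_slice C X) q r"
  obtain f where m_eq: "m = (p, f, q)" and f: "f \<in> hom C (src C p) (src C q)" "q \<cdot> f = p"
    and pq: "total C p" "tgt C p = X" "total C q"
    using m by (auto simp: hom_total_slice)
  obtain g where n_eq: "n = (q, g, r)" and g: "g \<in> hom C (src C q) (src C r)" "r \<cdot> g = q"
    and r: "total C r" "tgt C r = X"
    using n by (auto simp: hom_total_slice)
  have "r \<in> hom C (src C r) X" using r by (simp add: total_def hom_iff)
  then have "r \<cdot> (g \<cdot> f) = (r \<cdot> g) \<cdot> f" by (rule cmp_assoc[OF f(1) g(1)])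
  then have "r \<cdot> (g \<cdot> f) = p" using f(2) g(2) by simp
  then show "n \<cdot>\<^bsub>total_slice C X\<^esub> m \<in> hom (total_slice C X) p r"
    using pq r cmp_hom[OF f(1) g(1)] by (simp add: m_eq n_eq hom_total_slice)
next
  fix m p q assume m: "m \<in> hom (total_slice C X) p q"
  then obtain f where m_eq: "m = (p, f, q)" and f: "f \<in> hom C (src C p) (src C q)"
    unfolding hom_total_slice by blast
  show "m \<cdot>\<^bsub>total_slice C X\<^esub> ide (total_slice C X) p = m"
    using cmp_ide_right[OF f] by (simp add: m_eq)
  show "ide (total_slice C X) q \<cdot>\<^bsub>total_slice C X\<^esub> m = m"
    using cmp_ide_left[OF f] by (simp add: m_eq)
next
  fix l m n p q r v assume "l \<in> hom (total_slice C X) p q" "m \<in> hom (total_slice C X) q r"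
    "n \<in> hom (total_slice C X) r v"
  then obtain f g h where eqs: "l = (p, f, q)" "m = (q, g, r)" "n = (r, h, v)"
    and fgh: "f \<in> hom C (src C p) (src C q)" "g \<in> hom C (src C q) (src C r)"
      "h \<in> hom C (src C r) (src C v)"
    unfolding hom_total_slice by blast
  show "n \<cdot>\<^bsub>total_slice C X\<^esub> (m \<cdot>\<^bsub>total_slice C X\<^esub> l)
      = (n \<cdot>\<^bsub>total_slice C X\<^esub> m) \<cdot>\<^bsub>total_slice C X\<^esub> l"
    using cmp_assoc[OF fgh] by (simp add: eqs)
qed

lemma total_Ar: "total C p \<Longrightarrow> p \<in> Ar C"
  by (simp add: total_def)

lemma rst_total_cmp:
  assumes "total C q" "f \<in> Ar C" "src C q = tgt C f"
  shows "rst C (q \<cdot> f) = rst C f"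
  using rst_rst_cmp[of f q] assms by (simp add: total_def)

text \<open>Postcomposing with the total map \<open>q\<close> does not change restrictions, and
  \<open>q \<cdot> (f \<cdot> t)\<close> is \<open>p \<cdot> t\<close>.\<close>

lemma slice_map_section:
  assumes p: "total C p" and q: "total C q"
    and f: "f \<in> hom C (src C p) (src C q)" "q \<cdot> f = p" and t: "t \<in> partial_sections C p"
  shows "f \<cdot> t \<in> partial_sections C q" "rst C (f \<cdot> t) = rst C t"
proof -
  note [simp] = t[unfolded partial_sections_iff] f[unfolded hom_iff] total_Ar[OF p] total_Ar[OF q]
  have qft: "q \<cdot> (f \<cdot> t) = rst C t" using cmp_cmp[of t f q] f(2) by simp
  then show "rst C (f \<cdot> t) = rst C t"
    using rst_total_cmp[OF q, of "f \<cdot> t"] by simp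
  moreover have "tgt C p = tgt C q"
    using f(2) tgt_cmp[of f q] by simp
  ultimately show "f \<cdot> t \<in> partial_sections C q"
    using qft by (simp add: partial_sections_iff)
qed

text \<open>Local smallness enters here: the partial sections lie in a single hom-set, so they form
  a small set.\<close>

lemma presheaf_Gamma:
  assumes "smallness small" "locally_small small C" "p \<in> Ob (total_slice C X)"
  shows "presheaf small C X (Gamma_ob C p)"
proof -
  have p [simp]: "p \<in> Ar C" "tgt C p = X" using assms(3) total_Ar by auto
  have "small (hom C X (src C p))"
    using assms(2) src_Ob[of p] tgt_Ob[of p] by (simp add: locally_small_def)
  moreover have "partial_sections C p \<subseteq> hom C X (src C p)"
    by (auto simp: partial_sections_def)
  ultimately have "small (partial_sections C p)"
    using assms(1) by (meson smallness_def)
  then show ?thesis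
    using partial_sections_cmp_rids[of p] rst_cmp_rids
    by (auto simp: presheaf_def rst_rids partial_sections_iff rids_iff cmp_cmp)
qed

lemma is_functor_Gamma:
  assumes small: "smallness small" "locally_small small C"
  shows "is_functor (total_slice C X) (Psh small C X) (Gamma C)"
  unfolding is_functor_def
proof (intro conjI ballI impI category_total_slice category_Psh)
  show "on_ob (Gamma C) p \<in> Ob (Psh small C X)" if "p \<in> Ob (total_slice C X)" for p
    using presheaf_Gamma[OF small that] by simp
next
  fix m assume m: "m \<in> Ar (total_slice C X)"
  obtain p f q where m_eq: "m = (p, f, q)" by (cases m)
  have pq: "total C p" "total C q" "tgt C p = X" "tgt C q = X"
    and f: "f \<in> hom C (src C p) (src C q)" "q \<cdot> f = p"
    using m by (auto simp: m_eq)
  have "f \<cdot> (t \<cdot> e) = (f \<cdot> t) \<cdot> e" if "t \<in> partial_sections C p" "e \<in> rids C X" for t e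
    using that f pq by (intro cmp_cmp[symmetric]) (auto simp: partial_sections_iff rids_iff hom_iff)
  then have "psh_map small C X (Gamma_ob C p) (\<lambda>t \<in> partial_sections C p. f \<cdot> t) (Gamma_ob C q)"
    using presheaf_Gamma[OF small, of p X] presheaf_Gamma[OF small, of q X] pq slice_map_section[OF pq(1,2) f]
      partial_sections_cmp_rids[OF total_Ar[OF pq(1)]]
    by (auto simp: psh_map_def)
  then show "on_ar (Gamma C) m \<in> hom (Psh small C X) (on_ob (Gamma C) (src (total_slice C X) m))
      (on_ob (Gamma C) (tgt (total_slice C X) m))"
    by (simp add: m_eq hom_Psh)
next
  fix p assume "p \<in> Ob (total_slice C X)"
  then show "on_ar (Gamma C) (ide (total_slice C X) p) = ide (Psh small C X) (on_ob (Gamma C) p)"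
    by (auto simp: partial_sections_iff restrict_def)
next
  fix m n assume m: "m \<in> Ar (total_slice C X)" and n: "n \<in> Ar (total_slice C X)"
    and mn: "tgt (total_slice C X) m = src (total_slice C X) n"
  obtain p f q where m_eq: "m = (p, f, q)" by (cases m)
  moreover obtain g r where n_eq: "n = (q, g, r)" using mn by (cases n) (simp add: m_eq)
  have pq: "total C p" "total C q"
    and f: "f \<in> hom C (src C p) (src C q)" "q \<cdot> f = p" and g: "g \<in> hom C (src C q) (src C r)"
    using m n by (auto simp: m_eq n_eq)
  have "(g \<cdot> f) \<cdot> t = g \<cdot> (f \<cdot> t)" if "t \<in> partial_sections C p" for t
    using that f(1) g by (intro cmp_cmp) (auto simp: partial_sections_iff hom_iff)
  then show "on_ar (Gamma C) (n \<cdot>\<^bsub>total_slice C X\<^esub> m)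
      = on_ar (Gamma C) n \<cdot>\<^bsub>Psh small C X\<^esub> on_ar (Gamma C) m"
    using slice_map_section[OF pq f]
    by (auto simp: m_eq n_eq compose_def restrict_def)
qed

end

text \<open>The join taken in the whole hom-set is again a partial section: postcomposing with
  \<open>p\<close> and taking restrictions agree on the family, and both preserve its join. Being
  least among all maps, it is least among the sections.\<close>

lemma (in join_restriction_category) sheaf_cond_Gamma:
  assumes p: "total C p"
  shows "sheaf_cond (Gamma_ob C p)"
  unfolding sheaf_cond_def
proof (intro allI impI)
  let ?A = "src C p" and ?X = "tgt C p"
  have p_hom: "p \<in> hom C ?A ?X" using total_Ar[OF p] by (rule homI)
  fix F assume F: "F \<subseteq> carrier (Gamma_ob C p)"
    and comp: "\<forall>s \<in> F. \<forall>t \<in> F. psh_compat (Gamma_ob C p) s t"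
  have Fh: "F \<subseteq> hom C ?X ?A" and pF: "\<And>t. t \<in> F \<Longrightarrow> p \<cdot> t = rst C t"
    using F by (auto simp: partial_sections_def)
  obtain j where j: "is_join C ?X ?A F j"
    using join_ex[OF _ _ Fh] comp hom_Ob[OF p_hom] by (auto simp: psh_compat_def compat_def)
  have "(\<lambda>t. p \<cdot> t) ` F = rst C ` F" using pF by force
  then have "p \<cdot> j = rst C j"
    using is_join_unique[OF is_join_postcomp[OF j p_hom]] is_join_rst[OF j] by simp
  then have "j \<in> partial_sections C p"
    using is_join_hom[OF j] by (simp add: partial_sections_def)
  then have "is_lub_in (carrier (Gamma_ob C p)) (psh_le (Gamma_ob C p)) F j"
    using j by (auto simp: is_join_def is_lub_in_def psh_le_def rle_def partial_sections_def)
  then show "\<exists>j. is_lub_in (carrier (Gamma_ob C p)) (psh_le (Gamma_ob C p)) F j" by blast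
qed

section \<open>The glueing of a presheaf\<close>

locale glued_presheaves = join_restriction_category C
  for C :: "('o, 'm, 'z) rcat_scheme" (structure) +
  fixes small :: "'m set \<Rightarrow> bool" and X :: 'o and gl :: "('m, 'm) psh \<Rightarrow> ('m, 'm) glueing"
  assumes smallness: "smallness small"
    and locally_small: "locally_small small C"
    and X_Ob: "X \<in> Ob C"
    and glueing: "glueing_choice small C X gl"
begin

abbreviation "\<S> \<equiv> total_slice C X"
abbreviation "\<P> \<equiv> Psh small C X"
abbreviation "\<eta> \<equiv> unit_map C gl"
abbreviation "\<epsilon> \<equiv> counit_map small C X gl"

section \<open>Agreement of elements and the sections that name them\<close>

lemma agree_join:
  assumes A: "presheaf small C X A" and a: "a \<in> carrier A" and b: "b \<in> carrier A"
  shows "is_join C X X {e \<in> rids C X. rle C e (extent A a \<cdot> extent A b) \<and> act A a e = act A b e}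
           (agree C X A a b)"
    and "agree C X A a b \<in> rids C X"
proof -
  let ?E = "{e \<in> rids C X. rle C e (extent A a \<cdot> extent A b) \<and> act A a e = act A b e}"
  obtain j where j: "j \<in> rids C X" "is_join C X X ?E j"
    using rids_join_ex[OF X_Ob, of ?E] by blast
  then show "is_join C X X ?E (agree C X A a b)" "agree C X A a b \<in> rids C X"
    using join_eq[OF j(2)] by (simp_all add: agree_def)
qed

text \<open>The extent is the greatest member of the family that \<open>agree\<close> joins.\<close>

lemma agree_self:
  assumes A: "presheaf small C X A" and a: "a \<in> carrier A"
  shows "agree C X A a a = extent A a"
proof -
  note e = extent_rids[OF A a]
  have "is_join C X X {e \<in> rids C X. rle C e (extent A a \<cdot> extent A a) \<and> act A a e = act A a e}
          (extent A a)"
    using e rle_refl[of "extent A a"]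
    by (auto simp: is_join_def is_lub_in_def rids_idem[OF e] rids_def hom_iff)
  then show ?thesis using is_join_unique agree_join(1)[OF A a a] by blast
qed

lemma Delta_glueing:
  "presheaf small C X A \<Longrightarrow> is_glueing C X (carrier A) (agree C X A) (gl A)"
  using glueing by (simp add: glueing_choice_def)

lemma Delta_charted:
  assumes "presheaf small C X A"
  shows "charted C (src C (Delta_ob gl A)) X (Delta_ob gl A) (carrier A) (chart (gl A)) (sect (gl A))"
proof -
  note G = Delta_glueing[OF assms]
  then have "total C (glue_map (gl A))"
    by (simp add: is_glueing_def local_homeo_def)
  then show ?thesis
    using G by unfold_locales (auto simp: is_glueing_def Delta_ob_def total_def hom_iff)
qed

lemma Delta_local_homeo:
  assumes "presheaf small C X A"
  shows "local_homeo C (Delta_ob gl A)" "Delta_ob gl A \<in> Ob \<S>"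
proof -
  show lh: "local_homeo C (Delta_ob gl A)"
    using Delta_glueing[OF assms] by (simp add: is_glueing_def Delta_ob_def)
  then show "Delta_ob gl A \<in> Ob \<S>"
    using Delta_glueing[OF assms] by (simp add: is_glueing_def Delta_ob_def local_homeo_def)
qed

lemma chart_sect:
  "\<lbrakk>presheaf small C X A; a \<in> carrier A; b \<in> carrier A\<rbrakk>
    \<Longrightarrow> chart (gl A) b \<cdot> sect (gl A) a = agree C X A a b"
  using Delta_glueing by (simp add: is_glueing_def)

lemma sect_section:
  assumes "presheaf small C X A" "a \<in> carrier A"
  shows "sect (gl A) a \<in> partial_sections C (Delta_ob gl A)"
  using charted.s_section[OF Delta_charted] assms by blast

text \<open>The diagonal entry of the atlas is both the restriction of the section and the agreement
  of \<open>a\<close> with itself.\<close>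

lemma rst_sect:
  assumes "presheaf small C X A" "a \<in> carrier A"
  shows "rst C (sect (gl A) a) = extent A a"
  using charted.c_cmp_s[OF Delta_charted[OF assms(1)] assms(2)] chart_sect[OF assms(1,2,2)]
    agree_self[OF assms] by simp

text \<open>The chart of \<open>b\<close> applied to the section of \<open>a\<close> is the
  agreement, and over it that section coincides with the partial inverse of the chart.\<close>

lemma sect_agree:
  assumes A: "presheaf small C X A" and a: "a \<in> carrier A" and b: "b \<in> carrier A"
  shows "sect (gl A) a \<cdot> agree C X A a b = sect (gl A) b \<cdot> agree C X A a b"
  using charted.c_cmp_section(2)[OF Delta_charted[OF A] b sect_section[OF A a]]
    chart_sect[OF A a b] by simp

text \<open>The element \<open>a\<close> and its restriction \<open>b\<close> agree on the extent
  \<open>d\<close> of \<open>b\<close>, hence so do their sections; and the section of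
  \<open>b\<close> has domain exactly \<open>d\<close>.\<close>

lemma sect_act:
  assumes A: "presheaf small C X A" and a: "a \<in> carrier A" and e: "e \<in> rids C X"
  shows "sect (gl A) (act A a e) = sect (gl A) a \<cdot> e"
proof -
  define b where "b = act A a e"
  define d where "d = extent A a \<cdot> e"
  note ea = extent_rids[OF A a]
  have b: "b \<in> carrier A" using act_closed[OF A a e] by (simp add: b_def)
  have d: "d \<in> rids C X" using rids_cmp[OF ea e] by (simp add: d_def)
  have ext_b: "extent A b = d" using extent_act[OF A a e] by (simp add: b_def d_def)
  obtain D where D: "charted C D X (Delta_ob gl A) (carrier A) (chart (gl A)) (sect (gl A))"
    using Delta_charted[OF A] by blast
  interpret charted C D X "Delta_ob gl A" "carrier A" "chart (gl A)" "sect (gl A)"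
    by (fact D)
  have "extent A a \<cdot> d = d"
    using rids_idem_cmp[OF ea, of e] e by (simp add: d_def rids_iff)
  then have "rle C d (extent A a \<cdot> extent A b)"
    using ext_b d by (simp add: rle_refl rids_iff)
  moreover have "act A a d = act A b d"
    using act_act[OF A a ea e] act_extent[OF A a] act_extent[OF A b] ext_b
    by (simp add: b_def d_def)
  ultimately have "rle C d (agree C X A a b)"
    using is_join_upper[OF agree_join(1)[OF A a b], of d] d by simp
  moreover note m = agree_join(2)[OF A a b]
  ultimately have "d = agree C X A a b \<cdot> d" using rle_rst_iff[OF d m] by simp
  moreover have "sect (gl A) a \<cdot> (agree C X A a b \<cdot> d) = sect (gl A) b \<cdot> (agree C X A a b \<cdot> d)"
    using sect_agree[OF A a b] a b m d cmp_cmp[of d "agree C X A a b" "sect (gl A) a"]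
      cmp_cmp[of d "agree C X A a b" "sect (gl A) b"] by (simp add: rids_iff)
  ultimately have "sect (gl A) a \<cdot> d = sect (gl A) b \<cdot> d" by simp
  also have "sect (gl A) b \<cdot> d = sect (gl A) b"
    using rst_sect[OF A b] ext_b cmp_rst_self[of "sect (gl A) b"] b by simp
  also have "sect (gl A) a \<cdot> d = (sect (gl A) a \<cdot> extent A a) \<cdot> e"
    unfolding d_def using a e ea by (intro cmp_cmp[symmetric]) (auto simp: rids_iff)
  also have "sect (gl A) a \<cdot> extent A a = sect (gl A) a"
    using rst_sect[OF A a] cmp_rst_self[of "sect (gl A) a"] a by simp
  finally show ?thesis by (simp add: b_def)
qed

section \<open>The unit as a universal arrow\<close>

lemma psh_map_agree:
  assumes \<phi>: "psh_map small C X A \<phi> (Gamma_ob C q)" and q: "q \<in> Ob \<S>"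
    and a: "a \<in> carrier A" and b: "b \<in> carrier A"
  shows "\<phi> a \<cdot> agree C X A a b = \<phi> b \<cdot> agree C X A a b"
\<comment> \<open>In \<open>A\<close> itself equality on a family of idempotents need not pass to
  their join, but the values of \<open>\<phi>\<close> are maps of \<open>C\<close>, where it
  does.\<close>
proof (rule eq_on_join[OF agree_join(1)[OF psh_map_dom[OF \<phi>] a b]])
  show "\<phi> a \<in> hom C X (src C q)" "\<phi> b \<in> hom C X (src C q)"
    using psh_map_closed[OF \<phi> a] psh_map_closed[OF \<phi> b] q
    by (auto simp: partial_sections_def)
  fix e assume "e \<in> {e \<in> rids C X. rle C e (extent A a \<cdot> extent A b) \<and> act A a e = act A b e}"
  then show "\<phi> a \<cdot> e = \<phi> b \<cdot> e"
    using psh_map_act[OF \<phi> a, of e] psh_map_act[OF \<phi> b, of e] by simp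
qed

lemma psh_map_sect:
  assumes A: "presheaf small C X A"
  shows "psh_map small C X A (\<lambda>a \<in> carrier A. sect (gl A) a) (Gamma_ob C (Delta_ob gl A))"
  using A presheaf_Gamma[OF smallness locally_small Delta_local_homeo(2)[OF A]]
  by (auto simp: psh_map_def sect_section rst_sect sect_act act_closed)

lemma unit_hom:
  assumes "presheaf small C X A"
  shows "\<eta> A \<in> hom \<P> A (Gamma_ob C (Delta_ob gl A))"
  using psh_map_sect[OF assms] by (simp add: unit_map_def hom_Psh)

lemma Gamma_cmp_unit:
  assumes A: "presheaf small C X A"
  shows "on_ar (Gamma C) (Delta_ob gl A, h, q) \<cdot>\<^bsub>\<P>\<^esub> \<eta> A
    = (A, \<lambda>a \<in> carrier A. h \<cdot> sect (gl A) a, Gamma_ob C q)"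
  using sect_section[OF A] by (auto simp: unit_map_def compose_def restrict_def)

text \<open>The definite descriptions in \<open>Delta\<close> and \<open>counit_map\<close> rest on
  this unique existence. The map is prescribed to be \<open>\<phi> a\<close> on the section of
  \<open>a\<close>; the overlap idempotents of the charts are the agreements, over which these
  prescriptions are consistent.\<close>

lemma unit_universal:
  assumes A: "presheaf small C X A" and q: "q \<in> Ob \<S>" and m: "m \<in> hom \<P> A (Gamma_ob C q)"
  shows "\<exists>!h. h \<in> hom \<S> (Delta_ob gl A) q \<and> on_ar (Gamma C) h \<cdot>\<^bsub>\<P>\<^esub> \<eta> A = m"
proof -
  define D where "D = src C (Delta_ob gl A)"
  interpret charted C D X "Delta_ob gl A" "carrier A" "chart (gl A)" "sect (gl A)"
    using Delta_charted[OF A] by (simp only: D_def)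
  obtain \<phi> where m_eq: "m = (A, \<phi>, Gamma_ob C q)" and \<phi>: "psh_map small C X A \<phi> (Gamma_ob C q)"
    using m by (auto simp: hom_Psh)
  have q_hom: "q \<in> hom C (src C q) X" using q by (simp add: total_def hom_iff)
  have "\<exists>h \<in> hom C D (src C q).
      q \<cdot> h = Delta_ob gl A \<and> (\<forall>a \<in> carrier A. h \<cdot> sect (gl A) a = \<phi> a)"
  proof (rule lift_ex[OF q_hom])
    fix a b assume a: "a \<in> carrier A" and b: "b \<in> carrier A"
    show "\<phi> a \<cdot> (chart (gl A) a \<cdot> sect (gl A) b) = \<phi> b \<cdot> (chart (gl A) a \<cdot> sect (gl A) b)"
      using psh_map_agree[OF \<phi> q b a] chart_sect[OF A b a] by simp
  next
    fix a assume a: "a \<in> carrier A"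
    show "\<phi> a \<in> partial_sections C q" using psh_map_closed[OF \<phi> a] by simp
    show "rst C (\<phi> a) = rst C (sect (gl A) a)"
      using psh_map_extent[OF \<phi> a] rst_sect[OF A a] by simp
  qed
  then obtain h where h: "h \<in> hom C D (src C q)" "q \<cdot> h = Delta_ob gl A"
    and h_sect: "\<And>a. a \<in> carrier A \<Longrightarrow> h \<cdot> sect (gl A) a = \<phi> a" by blast
  have "(\<lambda>a \<in> carrier A. h \<cdot> sect (gl A) a) = \<phi>"
    using h_sect psh_map_extensional[OF \<phi>]
    by (intro extensionalityI[of _ "carrier A"]) (simp_all add: PiE_iff)
  then have "on_ar (Gamma C) (Delta_ob gl A, h, q) \<cdot>\<^bsub>\<P>\<^esub> \<eta> A = m"
    unfolding Gamma_cmp_unit[OF A] m_eq by simp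
  moreover have "(Delta_ob gl A, h, q) \<in> hom \<S> (Delta_ob gl A) q"
    using h q Delta_local_homeo(2)[OF A] unfolding hom_total_slice total_slice_simps D_def by blast
  ultimately have ex: "(Delta_ob gl A, h, q) \<in> hom \<S> (Delta_ob gl A) q \<and>
      on_ar (Gamma C) (Delta_ob gl A, h, q) \<cdot>\<^bsub>\<P>\<^esub> \<eta> A = m" by simp
  show ?thesis
  proof (rule ex1I[of _ "(Delta_ob gl A, h, q)"], rule ex)
    fix k assume k: "k \<in> hom \<S> (Delta_ob gl A) q \<and> on_ar (Gamma C) k \<cdot>\<^bsub>\<P>\<^esub> \<eta> A = m"
    then obtain g where k_eq: "k = (Delta_ob gl A, g, q)"
      and g: "g \<in> hom C D (src C q)"
      unfolding hom_total_slice D_def by blast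
    have restr: "(\<lambda>a \<in> carrier A. g \<cdot> sect (gl A) a) = (\<lambda>a \<in> carrier A. h \<cdot> sect (gl A) a)"
      using k ex unfolding k_eq Gamma_cmp_unit[OF A] by (metis Pair_inject)
    have "g \<cdot> sect (gl A) a = h \<cdot> sect (gl A) a" if "a \<in> carrier A" for a
      using fun_cong[OF restr, of a] that by simp
    then have "g = h" by (rule eqI[OF g h(1)])
    then show "k = (Delta_ob gl A, h, q)" by (simp add: k_eq)
  qed
qed

lemma counit:
  assumes p: "p \<in> Ob \<S>"
  shows counit_hom: "\<epsilon> p \<in> hom \<S> (Delta_ob gl (Gamma_ob C p)) p"
    and counit_unit: "on_ar (Gamma C) (\<epsilon> p) \<cdot>\<^bsub>\<P>\<^esub> \<eta> (Gamma_ob C p) = ide \<P> (Gamma_ob C p)"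
proof -
  have \<Gamma>p: "presheaf small C X (Gamma_ob C p)"
    using presheaf_Gamma[OF smallness locally_small p] .
  have "ide \<P> (Gamma_ob C p) \<in> hom \<P> (Gamma_ob C p) (Gamma_ob C p)"
    using psh_map_id[OF \<Gamma>p] by (simp add: hom_Psh)
  from theI'[OF unit_universal[OF \<Gamma>p p this]]
  show "\<epsilon> p \<in> hom \<S> (Delta_ob gl (Gamma_ob C p)) p"
    "on_ar (Gamma C) (\<epsilon> p) \<cdot>\<^bsub>\<P>\<^esub> \<eta> (Gamma_ob C p) = ide \<P> (Gamma_ob C p)"
    unfolding counit_map_def by blast+
qed

lemma Delta_ar:
  assumes f: "f \<in> hom \<P> A B"
  shows "on_ar (Delta small C X gl) f \<in> hom \<S> (Delta_ob gl A) (Delta_ob gl B)"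
    and "on_ar (Gamma C) (on_ar (Delta small C X gl) f) \<cdot>\<^bsub>\<P>\<^esub> \<eta> A = \<eta> B \<cdot>\<^bsub>\<P>\<^esub> f"
proof -
  interpret P: category \<P> by (fact category_Psh)
  have AB: "presheaf small C X A" "presheaf small C X B" using P.hom_Ob[OF f] by auto
  obtain g where f_eq: "f = (A, g, B)" using f by (auto simp: hom_Psh)
  have "\<eta> B \<cdot>\<^bsub>\<P>\<^esub> f \<in> hom \<P> A (Gamma_ob C (Delta_ob gl B))"
    using P.cmp_hom[OF f unit_hom[OF AB(2)]] .
  from theI'[OF unit_universal[OF AB(1) Delta_local_homeo(2)[OF AB(2)] this]]
  show "on_ar (Delta small C X gl) f \<in> hom \<S> (Delta_ob gl A) (Delta_ob gl B)"
    "on_ar (Gamma C) (on_ar (Delta small C X gl) f) \<cdot>\<^bsub>\<P>\<^esub> \<eta> A = \<eta> B \<cdot>\<^bsub>\<P>\<^esub> f"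
    unfolding Delta_def f_eq by simp_all
qed

lemma Delta_Gamma_adjunction:
  "adjunction \<S> \<P> (Delta small C X gl) (Gamma C) \<eta> \<epsilon>"
proof (rule universal_arrows_adjunction)
  interpret P: category \<P> by (fact category_Psh)
  interpret S: category \<S> by (fact category_total_slice)
  have Delta_on_ob: "on_ob (Delta small C X gl) = Delta_ob gl" by (simp add: Delta_def)
  show functor_Gamma: "is_functor \<S> \<P> (Gamma C)"
    using is_functor_Gamma[OF smallness locally_small] .
  show "category \<P>" by (fact category_Psh)
  show "on_ob (Delta small C X gl) A \<in> Ob \<S>" if "A \<in> Ob \<P>" for A
    using Delta_local_homeo(2) that by (simp add: Delta_on_ob)
  show "\<eta> A \<in> hom \<P> A (on_ob (Gamma C) (on_ob (Delta small C X gl) A))" if "A \<in> Ob \<P>" for A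
    using unit_hom that by (simp add: Delta_on_ob)
  show "on_ar (Delta small C X gl) f
      \<in> hom \<S> (on_ob (Delta small C X gl) (src \<P> f)) (on_ob (Delta small C X gl) (tgt \<P> f))"
    and "on_ar (Gamma C) (on_ar (Delta small C X gl) f) \<cdot>\<^bsub>\<P>\<^esub> \<eta> (src \<P> f) = \<eta> (tgt \<P> f) \<cdot>\<^bsub>\<P>\<^esub> f"
    if "f \<in> Ar \<P>" for f
    using Delta_ar[OF P.homI[OF that]] by (simp_all add: Delta_on_ob)
  show "\<epsilon> p \<in> hom \<S> (on_ob (Delta small C X gl) (on_ob (Gamma C) p)) p" if "p \<in> Ob \<S>" for p
    using counit_hom[OF that] by (simp add: Delta_on_ob)
  show "on_ar (Gamma C) (\<epsilon> p) \<cdot>\<^bsub>\<P>\<^esub> \<eta> (on_ob (Gamma C) p) = ide \<P> (on_ob (Gamma C) p)"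
    if "p \<in> Ob \<S>" for p
    using counit_unit[OF that] by simp
  fix A p h k
  assume A: "A \<in> Ob \<P>" and h: "h \<in> hom \<S> (on_ob (Delta small C X gl) A) p"
    and k: "k \<in> hom \<S> (on_ob (Delta small C X gl) A) p"
    and eq: "on_ar (Gamma C) h \<cdot>\<^bsub>\<P>\<^esub> \<eta> A = on_ar (Gamma C) k \<cdot>\<^bsub>\<P>\<^esub> \<eta> A"
  have A': "presheaf small C X A" and p: "p \<in> Ob \<S>" using A S.hom_Ob[OF h] by auto
  have "on_ar (Gamma C) h \<in> hom \<P> (Gamma_ob C (Delta_ob gl A)) (Gamma_ob C p)"
    using functor_Gamma h by (auto simp: is_functor_def S.hom_iff Delta_on_ob simp del: Gamma_simps(2))
  then have "on_ar (Gamma C) h \<cdot>\<^bsub>\<P>\<^esub> \<eta> A \<in> hom \<P> A (Gamma_ob C p)"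
    using P.cmp_hom[OF unit_hom[OF A']] by blast
  from unit_universal[OF A' p this] show "h = k"
    using h k eq by (metis Delta_on_ob)
qed

section \<open>Fixpoints\<close>

lemma counit_iso_imp_local_homeo:
  assumes p: "p \<in> Ob \<S>" and iso: "is_iso \<S> (\<epsilon> p)"
  shows "local_homeo C p"
proof -
  interpret S: category \<S> by (fact category_total_slice)
  let ?d = "Delta_ob gl (Gamma_ob C p)"
  have \<Gamma>p: "presheaf small C X (Gamma_ob C p)"
    using presheaf_Gamma[OF smallness locally_small p] .
  obtain e where e_eq: "\<epsilon> p = (?d, e, p)" and e: "e \<in> hom C (src C ?d) (src C p)"
    using counit_hom[OF p] unfolding hom_total_slice by blast
  obtain m where m: "m \<in> hom \<S> p ?d" "m \<cdot>\<^bsub>\<S>\<^esub> \<epsilon> p = ide \<S> ?d" "\<epsilon> p \<cdot>\<^bsub>\<S>\<^esub> m = ide \<S> p"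
    using S.is_isoE[OF iso counit_hom[OF p]] .
  obtain g where m_eq: "m = (p, g, ?d)" and g: "g \<in> hom C (src C p) (src C ?d)" "?d \<cdot> g = p"
    using m(1) unfolding hom_total_slice by blast
  have "e \<cdot> g = ide C (src C p)" "g \<cdot> e = ide C (src C ?d)"
    using m(2,3) by (simp_all add: m_eq e_eq)
  \<comment> \<open>The inverse \<open>g\<close> of the counit exhibits \<open>p\<close> as the
    local homeomorphism \<open>?d\<close> precomposed with an isomorphism.\<close>
  then show ?thesis
    using local_homeo_cmp_iso[OF Delta_local_homeo(1)[OF \<Gamma>p] _ g(1) e] g(2)
      Delta_local_homeo(2)[OF \<Gamma>p] by (auto simp: total_def hom_iff)
qed

text \<open>Two chartings meet: \<open>p\<close> is charted by its own partial isomorphisms, its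
  glueing \<open>d\<close> by all partial sections of \<open>p\<close>. One composite is therefore
  tested on the \<open>s f\<close>, the other on the sections of \<open>d\<close> named by every
  \<open>t\<close>, which is why \<open>k\<close> has to be computed on all of them.\<close>

lemma local_homeo_imp_counit_iso:
  assumes p: "p \<in> Ob \<S>" and lh: "local_homeo C p"
  shows "is_iso \<S> (\<epsilon> p)"
proof -
  interpret S: category \<S> by (fact category_total_slice)
  define A where "A = Gamma_ob C p"
  define B where "B = src C p"
  define d where "d = Delta_ob gl A"
  define D where "D = src C d"
  have p': "total C p" "tgt C p = X" using p by auto
  have A: "presheaf small C X A"
    using presheaf_Gamma[OF smallness locally_small p] by (simp add: A_def)
  have A_simps [simp]: "carrier A = partial_sections C p" "extent A = rst C" "\<And>t e. act A t e = t \<cdot> e"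
    by (simp_all add: A_def)
  obtain F :: "'m set" and c s where "charted C (src C p) (tgt C p) p F c s"
    using local_homeo_charted[OF lh] .
  then interpret F: charted C B X p F c s using p'(2) by (simp add: B_def)
  interpret D: charted C D X d "partial_sections C p" "chart (gl A)" "sect (gl A)"
    using Delta_charted[OF A] by (simp add: d_def D_def)
  have sec: "sect (gl A) t \<in> partial_sections C d" "rst C (sect (gl A) t) = rst C t"
    if "t \<in> partial_sections C p" for t
    using sect_section[OF A, of t] rst_sect[OF A, of t] that by (simp_all add: d_def)
  have sect_cmp: "sect (gl A) (t \<cdot> x) = sect (gl A) t \<cdot> x"
    if "t \<in> partial_sections C p" "x \<in> rids C X" for t x
    using sect_act[OF A, of t x] that by simp
  \<comment> \<open>Naming commutes with restriction, so the agreement of \<open>s f\<close> and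
    \<open>t\<close> over \<open>c f \<cdot> t\<close> is inherited by the sections of
    \<open>d\<close> that they name.\<close>
  have sect_F: "sect (gl A) (s f) \<cdot> (c f \<cdot> t) = sect (gl A) t \<cdot> (c f \<cdot> t)"
    if f: "f \<in> F" and t: "t \<in> partial_sections C p" for f t
    using F.c_cmp_section(2)[OF f t] sect_cmp[OF t F.c_cmp_section(1)[OF f t]]
      sect_cmp[OF F.s_section[OF f] F.c_cmp_section(1)[OF f t]] by simp
  obtain k where k: "k \<in> hom C B D" "d \<cdot> k = p"
    and k_s: "\<And>f. f \<in> F \<Longrightarrow> k \<cdot> s f = sect (gl A) (s f)"
  proof -
    have "\<exists>h \<in> hom C B D. d \<cdot> h = p \<and> (\<forall>f \<in> F. h \<cdot> s f = sect (gl A) (s f))"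
    proof (rule F.lift_ex[OF D.p_hom])
      fix f assume f: "f \<in> F"
      show "sect (gl A) (s f) \<in> partial_sections C d" "rst C (sect (gl A) (s f)) = rst C (s f)"
        using sec[OF F.s_section[OF f]] .
      fix g assume g: "g \<in> F"
      show "sect (gl A) (s f) \<cdot> (c f \<cdot> s g) = sect (gl A) (s g) \<cdot> (c f \<cdot> s g)"
        using sect_F[OF f F.s_section[OF g]] .
    qed
    then show ?thesis using that by blast
  qed
  have eps_hom: "\<epsilon> p \<in> hom \<S> d p" using counit_hom[OF p] by (simp only: d_def A_def)
  then obtain e where e_eq: "\<epsilon> p = (d, e, p)" and e: "e \<in> hom C D B"
    unfolding hom_total_slice B_def D_def by blast
  \<comment> \<open>Read elementwise, the identity that characterises the counit says that
    \<open>e\<close> sends the section named by \<open>t\<close> back to \<open>t\<close>.\<close>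
  have restr: "(\<lambda>t \<in> partial_sections C p. e \<cdot> sect (gl A) t) = (\<lambda>t \<in> partial_sections C p. t)"
    using counit_unit[OF p] Gamma_cmp_unit[OF A, of e p]
    by (simp add: e_eq d_def flip: A_def)
  have e_sect: "e \<cdot> sect (gl A) t = t" if "t \<in> partial_sections C p" for t
    using fun_cong[OF restr, of t] that by simp
  have s_hom: "s f \<in> hom C X B" if "f \<in> F" for f
    using that by (simp add: hom_iff)
  have sect_hom: "sect (gl A) t \<in> hom C X D" if "t \<in> partial_sections C p" for t
    using that by (simp add: hom_iff)
  have ek: "e \<cdot> k = ide C B"
  proof (rule F.eqI)
    show "e \<cdot> k \<in> hom C B B" "ide C B \<in> hom C B B"
      by (rule cmp_hom[OF k(1) e], rule ide_hom[OF F.p_simps(4)])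
    fix f assume f: "f \<in> F"
    have "(e \<cdot> k) \<cdot> s f = e \<cdot> (k \<cdot> s f)"
      using cmp_assoc[OF s_hom[OF f] k(1) e] by simp
    also have "\<dots> = s f" using k_s[OF f] e_sect F.s_section[OF f] by simp
    finally show "(e \<cdot> k) \<cdot> s f = ide C B \<cdot> s f" using f by simp
  qed
  \<comment> \<open>\<open>k\<close> was prescribed on the \<open>s f\<close> only; the domain of an
    arbitrary \<open>t\<close> is covered by the idempotents \<open>c f \<cdot> t\<close>, over each
    of which \<open>t\<close> coincides with \<open>s f\<close>.\<close>
  have k_sect: "k \<cdot> t = sect (gl A) t" if t: "t \<in> partial_sections C p" for t
  proof -
    have t' [simp]: "t \<in> Ar C" "src C t = X" "tgt C t = B"
      using t by (auto simp: partial_sections_iff)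
    have t_hom: "t \<in> hom C X B" by (simp add: hom_iff)
    have kt: "k \<cdot> t \<in> hom C X D" using cmp_hom[OF t_hom k(1)] .
    have "(k \<cdot> t) \<cdot> rst C t = sect (gl A) t \<cdot> rst C t"
    proof (rule eq_on_join[OF F.section_join[OF t] kt])
      show "sect (gl A) t \<in> hom C X D" using sect_hom[OF t] .
      fix x assume "x \<in> (\<lambda>f. c f \<cdot> t) ` F"
      then obtain f where f: "f \<in> F" and x: "x = c f \<cdot> t" by auto
      have ft: "c f \<cdot> t \<in> hom C X X" using F.c_cmp_section(1)[OF f t] by (simp add: rids_def)
      have "(k \<cdot> t) \<cdot> (c f \<cdot> t) = k \<cdot> (t \<cdot> (c f \<cdot> t))"
        using cmp_assoc[OF ft t_hom k(1)] by simp
      also have "\<dots> = k \<cdot> (s f \<cdot> (c f \<cdot> t))" using F.c_cmp_section(2)[OF f t] by simp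
      also have "\<dots> = (k \<cdot> s f) \<cdot> (c f \<cdot> t)"
        using cmp_assoc[OF ft s_hom[OF f] k(1)] .
      finally show "(k \<cdot> t) \<cdot> x = sect (gl A) t \<cdot> x"
        using k_s[OF f] sect_F[OF f t] x by simp
    qed
    moreover have "(k \<cdot> t) \<cdot> rst C t = k \<cdot> t"
      using cmp_rst_self[OF t'(1)] cmp_assoc[OF rst_hom[OF t_hom] t_hom k(1)] by simp
    moreover have "sect (gl A) t \<cdot> rst C t = sect (gl A) t"
      using sec(2)[OF t] cmp_rst_self[of "sect (gl A) t"] t by simp
    ultimately show ?thesis by simp
  qed
  have ke: "k \<cdot> e = ide C D"
  proof (rule D.eqI)
    show "k \<cdot> e \<in> hom C D D" "ide C D \<in> hom C D D"
      by (rule cmp_hom[OF e k(1)], rule ide_hom[OF D.p_simps(4)])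
    fix t assume t: "t \<in> partial_sections C p"
    have "(k \<cdot> e) \<cdot> sect (gl A) t = k \<cdot> (e \<cdot> sect (gl A) t)"
      using cmp_assoc[OF sect_hom[OF t] e k(1)] by simp
    then show "(k \<cdot> e) \<cdot> sect (gl A) t = ide C D \<cdot> sect (gl A) t"
      using e_sect[OF t] k_sect[OF t] t by simp
  qed
  have "(p, k, d) \<in> hom \<S> p d"
    using k p' Delta_local_homeo(2)[OF A]
    unfolding hom_total_slice total_slice_simps d_def[symmetric] B_def D_def by blast
  from S.is_isoI[OF eps_hom this] show ?thesis using ek ke by (simp add: e_eq)
qed

section \<open>Right fixpoints: the unit and sheaves\<close>

lemma unit_iso_imp_sheaf:
  assumes A: "presheaf small C X A" and iso: "is_iso \<P> (\<eta> A)"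
  shows "sheaf_cond A"
proof -
  let ?B = "Gamma_ob C (Delta_ob gl A)"
  obtain g where "psh_map small C X ?B g A"
    and "\<And>a. a \<in> carrier A \<Longrightarrow> g ((\<lambda>a \<in> carrier A. sect (gl A) a) a) = a"
    and "\<And>b. b \<in> carrier ?B \<Longrightarrow> (\<lambda>a \<in> carrier A. sect (gl A) a) (g b) = b"
    using iso unfolding unit_map_def is_iso_Psh_iff by blast
  \<comment> \<open>Partial sections of a total map always form a sheaf, and the sheaf condition is
    invariant under isomorphism.\<close>
  moreover have "sheaf_cond ?B"
    using sheaf_cond_Gamma Delta_local_homeo(2)[OF A] by simp
  ultimately show ?thesis using sheaf_cond_iso[OF psh_map_sect[OF A]] by blast
qed

text \<open>Equal sections make \<open>agree C X A a b\<close> equal to the common extent, which is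
  then covered by idempotents on which \<open>a\<close> and \<open>b\<close> coincide. The common
  restrictions have a join lying below both elements and of the same extent, so it equals each of
  them.\<close>

lemma sect_inj:
  assumes A: "presheaf small C X A" and sheaf: "sheaf_cond A"
    and a: "a \<in> carrier A" and b: "b \<in> carrier A" and eq: "sect (gl A) a = sect (gl A) b"
  shows "a = b"
proof -
  define E where "E = {e \<in> rids C X. rle C e (extent A a \<cdot> extent A b) \<and> act A a e = act A b e}"
  have ext: "extent A a = extent A b"
    using rst_sect[OF A a] rst_sect[OF A b] eq by simp
  note ea = extent_rids[OF A a]
  \<comment> \<open>Exchanging the section of \<open>a\<close> for that of \<open>b\<close> turns
    this atlas entry into the diagonal entry at \<open>b\<close>.\<close>
  have "agree C X A a b = extent A a"
    using chart_sect[OF A a b] chart_sect[OF A b b] eq agree_self[OF A b] ext by simp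
  then have E: "is_join C X X E (extent A a)"
    using agree_join(1)[OF A a b] by (simp add: E_def)
  have E_rids: "e \<in> rids C X" "act A a e = act A b e" "extent A a \<cdot> e = e" if "e \<in> E" for e
    using that is_join_upper[OF E that] rle_rst_iff[OF _ ea, of e] by (auto simp: E_def)
  have ext_e: "extent A (act A a e) = e" if "e \<in> E" for e
    using extent_act[OF A a E_rids(1)[OF that]] E_rids(3)[OF that] by simp
  let ?F = "act A a ` E"
  have compat: "psh_compat A (act A a d) (act A a e)" if "d \<in> E" "e \<in> E" for d e
  proof -
    note d = E_rids(1)[OF that(1)] and e = E_rids(1)[OF that(2)]
    show ?thesis
      using act_act[OF A a d e] act_act[OF A a e d] rids_commute[OF d e] ext_e[OF that(1)]
        ext_e[OF that(2)] by (simp add: psh_compat_def)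
  qed
  have "\<exists>j. is_lub_in (carrier A) (psh_le A) ?F j"
    by (rule sheaf_join_ex[OF sheaf]) (simp_all only: act_closed[OF A a E_rids(1)] compat)
  then obtain j where j: "is_lub_in (carrier A) (psh_le A) ?F j" ..
  have jA: "j \<in> carrier A" using j by (simp add: is_lub_in_def)
  note ej = extent_rids[OF A jA]
  have le_a: "psh_le A x a" and le_b: "psh_le A x b" if "x \<in> ?F" for x
  proof -
    obtain e where e: "e \<in> E" "x = act A a e" using \<open>x \<in> ?F\<close> by blast
    then show "psh_le A x a" "psh_le A x b"
      using ext_e[OF e(1)] E_rids(2)[OF e(1)] by (simp_all add: psh_le_def)
  qed
  have "psh_le A j a" "psh_le A j b"
    using j a b le_a le_b unfolding is_lub_in_def by blast+
  then have j_eq: "j = act A a (extent A j)" "j = act A b (extent A j)"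
    by (simp_all add: psh_le_def)
  have ej_le: "extent A j = extent A a \<cdot> extent A j"
    using extent_act[OF A a ej] unfolding j_eq(1)[symmetric] .
  \<comment> \<open>The extent of \<open>j\<close> dominates every member of \<open>E\<close>, hence
    their join \<open>extent A a\<close>; the other inequality comes from \<open>j\<close> lying
    below \<open>a\<close>.\<close>
  have "rle C (extent A a) (extent A j)"
  proof (rule is_join_least[OF E])
    show "extent A j \<in> hom C X X" using ej by (simp add: rids_def)
    fix e assume e: "e \<in> E"
    then have "psh_le A (act A a e) j" using j by (simp add: is_lub_in_def)
    then have "act A a e = act A j e" using ext_e[OF e] by (simp add: psh_le_def)
    then have "e = extent A j \<cdot> e"
      using ext_e[OF e] extent_act[OF A jA E_rids(1)[OF e]] by simp
    then show "rle C e (extent A j)" using rle_rst_iff[OF E_rids(1)[OF e] ej] by simp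
  qed
  then have "extent A a = extent A j \<cdot> extent A a"
    by (rule rle_rst_iff[OF ea ej, THEN iffD1])
  then have ext_j: "extent A j = extent A a"
    using ej_le rids_commute[OF ea ej] by metis
  have "j = a" using j_eq(1) unfolding ext_j act_extent[OF A a] .
  moreover have "j = b" using j_eq(2) unfolding ext_j ext act_extent[OF A b] .
  ultimately show ?thesis by simp
qed

lemma sect_surj:
  assumes A: "presheaf small C X A" and sheaf: "sheaf_cond A"
    and t: "t \<in> partial_sections C (Delta_ob gl A)"
  shows "\<exists>a \<in> carrier A. sect (gl A) a = t"
proof -
  let ?s = "sect (gl A)"
  obtain D where D: "charted C D X (Delta_ob gl A) (carrier A) (chart (gl A)) ?s"
    using Delta_charted[OF A] by blast
  interpret charted C D X "Delta_ob gl A" "carrier A" "chart (gl A)" ?s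
    by (fact D)
  have t' [simp]: "t \<in> Ar C" "src C t = X" "tgt C t = D"
    using t by (auto simp: partial_sections_iff)
  define e where "e a = chart (gl A) a \<cdot> t" for a
  have e: "e a \<in> rids C X" "?s a \<cdot> e a = t \<cdot> e a" if "a \<in> carrier A" for a
    using c_cmp_section[OF that t] by (auto simp: e_def)
  \<comment> \<open>The chart of \<open>a\<close> takes values in \<open>extent A a\<close>, so
    \<open>e a\<close> lies below this extent.\<close>
  have ext_e: "extent A (act A a (e a)) = e a" if a: "a \<in> carrier A" for a
  proof -
    have "extent A a \<cdot> chart (gl A) a = chart (gl A) a"
      using rst_sect[OF A a] c_cmp_s[OF a] s_cmp_c[OF a] a
        cmp_cmp[of "chart (gl A) a" "?s a" "chart (gl A) a"] by simp
    then have "extent A a \<cdot> e a = e a"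
      using a extent_rids[OF A a] cmp_cmp[of t "chart (gl A) a" "extent A a"]
      by (simp add: e_def rids_iff)
    then show ?thesis using extent_act[OF A a e(1)[OF a]] by simp
  qed
  let ?F = "(\<lambda>a. act A a (e a)) ` carrier A"
  have F: "act A a (e a) \<in> carrier A" if "a \<in> carrier A" for a
    using act_closed[OF A that e(1)[OF that]] .
  \<comment> \<open>Compatibility is verified on sections: both sides name \<open>t\<close>
    restricted to \<open>e a \<cdot> e b\<close>, and injectivity brings the equality back to
    \<open>A\<close>.\<close>
  have compat: "psh_compat A (act A a (e a)) (act A b (e b))" if a: "a \<in> carrier A" and b: "b \<in> carrier A" for a b
  proof -
    note ea = e(1)[OF a] and eb = e(1)[OF b]
    have "?s (act A (act A a (e a)) (e b)) = (?s a \<cdot> e a) \<cdot> e b"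
      using sect_act[OF A] F[OF a] a ea eb by simp
    also have "\<dots> = t \<cdot> (e a \<cdot> e b)"
      using e(2)[OF a] ea eb by (simp add: cmp_cmp rids_iff)
    also have "e a \<cdot> e b = e b \<cdot> e a" using rids_commute[OF ea eb] .
    also have "t \<cdot> (e b \<cdot> e a) = (?s b \<cdot> e b) \<cdot> e a"
      using e(2)[OF b] ea eb by (simp add: cmp_cmp rids_iff)
    also have "\<dots> = ?s (act A (act A b (e b)) (e a))"
      using sect_act[OF A] F[OF b] b ea eb by simp
    finally have "act A (act A a (e a)) (e b) = act A (act A b (e b)) (e a)"
      using sect_inj[OF A sheaf] act_closed[OF A] F a b ea eb by blast
    then show ?thesis using ext_e a b by (simp add: psh_compat_def)
  qed
  have "\<exists>j. is_lub_in (carrier A) (psh_le A) ?F j"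
    by (rule sheaf_join_ex[OF sheaf]) (simp_all only: F compat)
  then obtain j where j: "is_lub_in (carrier A) (psh_le A) ?F j" ..
  have jA: "j \<in> carrier A" using j by (simp add: is_lub_in_def)
  have "?s j \<cdot> rst C t = t \<cdot> rst C t"
  proof (rule eq_on_join[OF section_join[OF t]])
    show "?s j \<in> hom C X D" "t \<in> hom C X D"
      using jA by (simp_all add: hom_iff)
    fix x assume "x \<in> (\<lambda>a. chart (gl A) a \<cdot> t) ` carrier A"
    then obtain a where a: "a \<in> carrier A" and x: "x = e a" by (auto simp: e_def)
    have "psh_le A (act A a (e a)) j" using j a by (simp add: is_lub_in_def)
    then have "act A a (e a) = act A j (e a)" using ext_e[OF a] by (simp add: psh_le_def)
    then have "?s a \<cdot> e a = ?s j \<cdot> e a"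
      using sect_act[OF A a e(1)[OF a]] sect_act[OF A jA e(1)[OF a]] by simp
    then show "?s j \<cdot> x = t \<cdot> x" using e(2)[OF a] x by simp
  qed
  \<comment> \<open>Cutting \<open>j\<close> down to \<open>rst C t\<close> gives a preimage of
    \<open>t\<close> without a computation of the extent of \<open>j\<close>.\<close>
  then have "?s (act A j (rst C t)) = t"
    using sect_act[OF A jA, of "rst C t"] by (simp add: rst_rids)
  then show ?thesis using act_closed[OF A jA, of "rst C t"] by (auto simp: rst_rids)
qed

lemma sheaf_imp_unit_iso:
  assumes A: "presheaf small C X A" and sheaf: "sheaf_cond A"
  shows "is_iso \<P> (\<eta> A)"
  unfolding unit_map_def
proof (rule bij_psh_map_is_iso[OF psh_map_sect[OF A]])
  show "bij_betw (\<lambda>a \<in> carrier A. sect (gl A) a) (carrier A) (carrier (Gamma_ob C (Delta_ob gl A)))"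
    unfolding bij_betw_def
  proof
    show "inj_on (\<lambda>a \<in> carrier A. sect (gl A) a) (carrier A)"
      using sect_inj[OF A sheaf] by (auto intro!: inj_onI)
    show "(\<lambda>a \<in> carrier A. sect (gl A) a) ` carrier A = carrier (Gamma_ob C (Delta_ob gl A))"
      using sect_section[OF A] sect_surj[OF A sheaf] by (force simp: image_iff)
  qed
qed

lemma left_fixpoints_counit: "left_fixpoints \<S> \<epsilon> = Ob (lh_slice C X)"
  using counit_iso_imp_local_homeo local_homeo_imp_counit_iso
  by (auto simp: left_fixpoints_def lh_slice_def)

lemma right_fixpoints_unit: "right_fixpoints \<P> \<eta> = Ob (Sh small C X)"
  using unit_iso_imp_sheaf sheaf_imp_unit_iso
  by (auto simp: right_fixpoints_def Sh_def)

end

theorem theorem4p15: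
  fixes C :: "('o, 'm) rcat"
    and small :: "'m set \<Rightarrow> bool"
    and X :: 'o
    and gl :: "('m, 'm) psh \<Rightarrow> ('m, 'm) glueing"
  assumes "smallness small"
    and "join_restriction_category C"
    and "locally_small small C"
    and "has_local_glueings small C"
    and "X \<in> Ob C"
    and "glueing_choice small C X gl"
  shows "adjunction (total_slice C X) (Psh small C X)
           (Delta small C X gl) (Gamma C) (unit_map C gl) (counit_map small C X gl) \<and>
         left_fixpoints (total_slice C X) (counit_map small C X gl) = Ob (lh_slice C X) \<and>
         right_fixpoints (Psh small C X) (unit_map C gl) = Ob (Sh small C X) \<and>
         adjoint_equivalence (lh_slice C X) (Sh small C X)
           (Delta small C X gl) (Gamma C) (unit_map C gl) (counit_map small C X gl)"
proof -
  interpret glued_presheaves C small X gl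
    using assms by (simp add: glued_presheaves_def glued_presheaves_axioms_def)
  show ?thesis
    using Delta_Gamma_adjunction left_fixpoints_counit right_fixpoints_unit
      adjoint_equivalence_fixpoints[OF Delta_Gamma_adjunction
        left_fixpoints_counit[unfolded lh_slice_def] right_fixpoints_unit[unfolded Sh_def]]
    by (simp add: lh_slice_def Sh_def)
qed

end
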